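(* Let $n\ge 2$. There are no complete maximal hypersurfaces $\psi:M\to\overline M$ ($M$ nonempty and connected) bounded away from future infinity in the $(n+1)$-dimensional Einstein-de Sitter spacetime $\overline M=\mathbb{R}^+\times_{t^{2/3}}\mathbb{R}^n$.
   Context: For an open interval $I\subseteq\mathbb{R}$ and a smooth function $f:I\to(0,\infty)$, $I\times_f\mathbb{R}^n$ denotes the product manifold $I\times\mathbb{R}^n$ with the Lorentzian metric $\bar g=-dt^2+f(t)^2 g_{\mathbb{R}^n}$, where $g_{\mathbb{R}^n}$ is the Euclidean metric, time-oriented by $\partial_t$. The Einstein-de Sitter spacetime is the case $I=\mathbb{R}^+=(0,\infty)$, $f(t)=t^{2/3}$. A spacelike hypersurface is an immersion $\psi:M\to\overline M$ of an $n$-dimensional manifold $M$ such that the induced metric $g_M=\psi^*\bar g$ is Riemannian; it is complete if $(M,g_M)$ is complete. Put $\tau:=\pi_I\circ\psi$, with $\pi_I$ the projection onto $I$. The hypersurface is bounded away from future infinity if $\sup_M\tau<\infty$. Let $N$ be the unit timelike normal vector field along $\psi$ with the same time-orientation as $\partial_t$, $AX=-\overline\nabla_X N$ the shape operator ($\overline\nabla$ the Levi-Civita connection of $\bar g$), and $H=-\frac1n\mathrm{trace}(A)$ the mean curvature. The hypersurface is maximal if $H\equiv 0$. *)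

theory Defs
  imports "HOL-Analysis.Analysis"
begin

section \<open>Smooth maps and smooth manifolds\<close>

text \<open>\<open>C\<^sup>k\<close> and smooth maps between normed spaces; meaningful only for open \<open>S\<close>.\<close>

primrec Ck_on :: "nat \<Rightarrow> ('a::real_normed_vector \<Rightarrow> 'b::real_normed_vector) \<Rightarrow> 'a set \<Rightarrow> bool" where
  "Ck_on 0 f S \<longleftrightarrow> continuous_on S f"
| "Ck_on (Suc k) f S \<longleftrightarrow>
     (\<forall>x\<in>S. f differentiable (at x)) \<and>
     (\<forall>v. Ck_on k (\<lambda>x. frechet_derivative f (at x) v) S)"

definition smooth_on :: "('a::real_normed_vector \<Rightarrow> 'b::real_normed_vector) \<Rightarrow> 'a set \<Rightarrow> bool" where
  "smooth_on f S \<longleftrightarrow> (\<forall>k. Ck_on k f S)"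

text \<open>A chart is a pair of a domain and a coordinate map defined on it.\<close>

type_synonym ('a, 'n) chart = "'a set \<times> ('a \<Rightarrow> real ^ 'n)"

abbreviation chart_dom :: "('a, 'n) chart \<Rightarrow> 'a set" where
  "chart_dom c \<equiv> fst c"

abbreviation chart_map :: "('a, 'n) chart \<Rightarrow> 'a \<Rightarrow> real ^ 'n" where
  "chart_map c \<equiv> snd c"

abbreviation chart_im :: "('a, 'n) chart \<Rightarrow> (real ^ 'n) set" where
  "chart_im c \<equiv> chart_map c ` chart_dom c"

abbreviation chart_inv :: "('a, 'n) chart \<Rightarrow> real ^ 'n \<Rightarrow> 'a" where
  "chart_inv c \<equiv> inv_into (chart_dom c) (chart_map c)"

definition is_chart :: "'a topology \<Rightarrow> ('a, 'n::finite) chart \<Rightarrow> bool" where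
  "is_chart M c \<longleftrightarrow>
     openin M (chart_dom c) \<and> open (chart_im c) \<and>
     homeomorphic_map (subtopology M (chart_dom c)) (top_of_set (chart_im c)) (chart_map c)"

definition smooth_atlas :: "'a topology \<Rightarrow> ('a, 'n::finite) chart set \<Rightarrow> bool" where
  "smooth_atlas M A \<longleftrightarrow>
     (\<forall>c\<in>A. is_chart M c) \<and> (\<Union>c\<in>A. chart_dom c) = topspace M \<and>
     (\<forall>c\<in>A. \<forall>d\<in>A.
        smooth_on (chart_map d \<circ> chart_inv c) (chart_map c ` (chart_dom c \<inter> chart_dom d)))"

text \<open>Smooth manifold of dimension \<open>CARD('n)\<close>, not necessarily connected: Hausdorff, second
  countable, with a (not necessarily maximal) smooth atlas.\<close>

definition smooth_manifold :: "'a topology \<Rightarrow> ('a, 'n::finite) chart set \<Rightarrow> bool" where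
  "smooth_manifold M A \<longleftrightarrow>
     Hausdorff_space M \<and>
     (\<exists>\<B>. countable \<B> \<and> (\<forall>V\<in>\<B>. openin M V) \<and>
          (\<forall>W p. openin M W \<and> p \<in> W \<longrightarrow> (\<exists>V\<in>\<B>. p \<in> V \<and> V \<subseteq> W))) \<and>
     smooth_atlas M A"

definition chart_at :: "('a, 'n) chart set \<Rightarrow> 'a \<Rightarrow> ('a, 'n) chart" where
  "chart_at A p = (SOME c. c \<in> A \<and> p \<in> chart_dom c)"


section \<open>Completeness of Riemannian manifolds\<close>

text \<open>A metric tensor on a manifold is given by its coordinate expressions: \<open>G c p v w\<close> is the
  value at \<open>p\<close> on the two tangent vectors with components \<open>v\<close>, \<open>w\<close> in the chart \<open>c\<close>.\<close>

type_synonym ('a, 'n) metric_tensor =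
  "('a, 'n) chart \<Rightarrow> 'a \<Rightarrow> real ^ 'n \<Rightarrow> real ^ 'n \<Rightarrow> real"

text \<open>\<open>C\<^sup>1\<close> on the closed interval, with one-sided derivatives at its end points.\<close>

definition C1_curve_on ::
  "('a, 'n::finite) chart set \<Rightarrow> real \<Rightarrow> real \<Rightarrow> (real \<Rightarrow> 'a) \<Rightarrow> bool" where
  "C1_curve_on A a b \<gamma> \<longleftrightarrow>
     (\<forall>c\<in>A. let J = {t \<in> {a..b}. \<gamma> t \<in> chart_dom c} in
        (\<forall>t\<in>J. (chart_map c \<circ> \<gamma>) differentiable (at t within {a..b})) \<and>
        continuous_on J (\<lambda>t. vector_derivative (chart_map c \<circ> \<gamma>) (at t within {a..b})))"

definition piecewise_C1_curve ::
  "'a topology \<Rightarrow> ('a, 'n::finite) chart set \<Rightarrow> (real \<Rightarrow> 'a) \<Rightarrow> bool" where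
  "piecewise_C1_curve M A \<gamma> \<longleftrightarrow>
     pathin M \<gamma> \<and>
     (\<exists>S. finite S \<and>
        (\<forall>a b. 0 \<le> a \<and> a < b \<and> b \<le> 1 \<and> {a<..<b} \<inter> S = {} \<longrightarrow> C1_curve_on A a b \<gamma>))"

text \<open>At the finitely many break points the integrand is irrelevant.\<close>

definition curve_length ::
  "('a, 'n::finite) chart set \<Rightarrow> ('a, 'n) metric_tensor \<Rightarrow> (real \<Rightarrow> 'a) \<Rightarrow> real" where
  "curve_length A G \<gamma> =
     integral {0..1}
       (\<lambda>t. let c = chart_at A (\<gamma> t); v = vector_derivative (chart_map c \<circ> \<gamma>) (at t)
            in sqrt (G c (\<gamma> t) v v))"

definition riemannian_dist ::
  "'a topology \<Rightarrow> ('a, 'n::finite) chart set \<Rightarrow> ('a, 'n) metric_tensor \<Rightarrow> 'a \<Rightarrow> 'a \<Rightarrow> real" where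
  "riemannian_dist M A G p q =
     Inf {curve_length A G \<gamma> |\<gamma>. piecewise_C1_curve M A \<gamma> \<and> \<gamma> 0 = p \<and> \<gamma> 1 = q}"

text \<open>Completeness as a metric space, for connected \<open>M\<close>.\<close>

definition complete_riemannian ::
  "'a topology \<Rightarrow> ('a, 'n::finite) chart set \<Rightarrow> ('a, 'n) metric_tensor \<Rightarrow> bool" where
  "complete_riemannian M A G \<longleftrightarrow>
     (\<forall>\<sigma> :: nat \<Rightarrow> 'a.
        range \<sigma> \<subseteq> topspace M \<and>
        (\<forall>e>0. \<exists>N. \<forall>i\<ge>N. \<forall>j\<ge>N. riemannian_dist M A G (\<sigma> i) (\<sigma> j) < e)
        \<longrightarrow> (\<exists>p\<in>topspace M. (\<lambda>i. riemannian_dist M A G (\<sigma> i) p) \<longlonglongrightarrow> 0))"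


section \<open>The ambient spacetime\<close>

text \<open>The manifold \<open>I \<times> \<real>\<^sup>n\<close> is the open subset \<open>I \<times> UNIV\<close> of the vector space
  \<open>\<real> \<times> \<real>\<^sup>n\<close>; its tangent spaces are identified with the latter.\<close>

type_synonym 'n spacetime = "real \<times> (real ^ 'n)"

definition grw_domain :: "real set \<Rightarrow> ('n::finite) spacetime set" where
  "grw_domain I = I \<times> UNIV"

definition grw_metric ::
  "(real \<Rightarrow> real) \<Rightarrow> ('n::finite) spacetime \<Rightarrow> 'n spacetime \<Rightarrow> 'n spacetime \<Rightarrow> real" where
  "grw_metric f p v w = - (fst v * fst w) + (f (fst p))\<^sup>2 * (snd v \<bullet> snd w)"

definition time_field :: "('n::finite) spacetime" where
  "time_field = (1, 0)"

definition eds_domain :: "('n::finite) spacetime set" where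
  "eds_domain = grw_domain {0<..}"

definition eds_metric :: "('n::finite) spacetime \<Rightarrow> 'n spacetime \<Rightarrow> 'n spacetime \<Rightarrow> real" where
  "eds_metric = grw_metric (\<lambda>t. t powr (2/3))"

text \<open>On an open subset of a vector space every connection has the form
  \<open>\<nabla>\<^sub>X Y = D\<^sub>X Y + \<Gamma>(X, Y)\<close>. It is torsion free iff \<open>\<Gamma>\<close> is symmetric and compatible
  with \<open>g\<close> iff \<open>u(g(v, w)) = g(\<nabla>\<^sub>u v, w) + g(v, \<nabla>\<^sub>u w)\<close> for all constant vector fields.\<close>

definition levi_civita_at ::
  "('e \<Rightarrow> 'e \<Rightarrow> 'e \<Rightarrow> real) \<Rightarrow> 'e::euclidean_space \<Rightarrow> ('e \<Rightarrow> 'e \<Rightarrow> 'e) \<Rightarrow> bool" where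
  "levi_civita_at g p \<Gamma> \<longleftrightarrow>
     bilinear \<Gamma> \<and> (\<forall>v w. \<Gamma> v w = \<Gamma> w v) \<and>
     (\<forall>u v w. frechet_derivative (\<lambda>q. g q v w) (at p) u = g p (\<Gamma> u v) w + g p v (\<Gamma> u w))"

definition christoffel ::
  "('e \<Rightarrow> 'e \<Rightarrow> 'e \<Rightarrow> real) \<Rightarrow> 'e::euclidean_space \<Rightarrow> 'e \<Rightarrow> 'e \<Rightarrow> 'e" where
  "christoffel g p = (THE \<Gamma>. levi_civita_at g p \<Gamma>)"

lemma christoffel_eqI:
  fixes g :: "'e::euclidean_space \<Rightarrow> 'e \<Rightarrow> 'e \<Rightarrow> real"
  assumes \<Gamma>: "levi_civita_at g p \<Gamma>"
    and bil: "bilinear (g p)" and sym: "\<And>v w. g p v w = g p w v"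
    and nondeg: "\<And>v. (\<And>w. g p v w = 0) \<Longrightarrow> v = 0"
  shows "christoffel g p = \<Gamma>"
proof -
  have koszul: "2 * g p (B u v) w = frechet_derivative (\<lambda>q. g q v w) (at p) u
      + frechet_derivative (\<lambda>q. g q u w) (at p) v - frechet_derivative (\<lambda>q. g q u v) (at p) w"
    if B: "levi_civita_at g p B" for B u v w
  proof -
    have s: "B v w = B w v" for v w using B unfolding levi_civita_at_def by blast
    have c: "frechet_derivative (\<lambda>q. g q v w) (at p) u = g p (B u v) w + g p v (B u w)" for u v w
      using B unfolding levi_civita_at_def by blast
    show ?thesis
      unfolding c using s[of u v] s[of u w] s[of v w] sym[of "B u w" v] sym[of "B v w" u]
        sym[of v "B w u"] sym[of u "B w v"] by simp
  qed
  have "B = \<Gamma>" if B: "levi_civita_at g p B" for B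
  proof (intro ext)
    fix u v
    have "g p (B u v - \<Gamma> u v) w = 0" for w
      using koszul[OF B, of u v w] koszul[OF \<Gamma>, of u v w] bilinear_lsub[OF bil] by simp
    then show "B u v = \<Gamma> u v" using nondeg by force
  qed
  then show ?thesis
    unfolding christoffel_def using \<Gamma> by blast
qed

text \<open>Well-definedness of the connection for the metrics of interest.\<close>

lemma christoffel_grw:
  fixes p :: "('n::finite) spacetime"
  assumes f: "(f has_real_derivative f') (at (fst p))" and pos: "f (fst p) > 0"
  shows "christoffel (grw_metric f) p =
    (\<lambda>v w. (f (fst p) * f' * (snd v \<bullet> snd w),
       (f' / f (fst p)) *\<^sub>R (fst v *\<^sub>R snd w + fst w *\<^sub>R snd v)))"
proof (rule christoffel_eqI)
  have d: "((\<lambda>q. grw_metric f q v w) has_derivative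
      (\<lambda>u. 2 * f (fst p) * (f' * fst u) * (snd v \<bullet> snd w))) (at p)" for v w :: "'n spacetime"
  proof -
    have "(f has_derivative (*) f') (at (fst p))"
      using f by (simp add: has_field_derivative_def)
    from has_derivative_compose[OF has_derivative_fst[OF has_derivative_ident] this]
    have "((\<lambda>q. f (fst q)) has_derivative (\<lambda>u. f' * fst u)) (at p)" .
    then show ?thesis
      unfolding grw_metric_def by (auto intro!: derivative_eq_intros)
  qed
  show "levi_civita_at (grw_metric f) p (\<lambda>v w. (f (fst p) * f' * (snd v \<bullet> snd w),
       (f' / f (fst p)) *\<^sub>R (fst v *\<^sub>R snd w + fst w *\<^sub>R snd v)))"
    unfolding levi_civita_at_def
  proof (intro conjI allI)
    fix u v w :: "'n spacetime"
    show "frechet_derivative (\<lambda>q. grw_metric f q v w) (at p) u =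
       grw_metric f p (f (fst p) * f' * (snd u \<bullet> snd v),
         (f' / f (fst p)) *\<^sub>R (fst u *\<^sub>R snd v + fst v *\<^sub>R snd u)) w +
       grw_metric f p v (f (fst p) * f' * (snd u \<bullet> snd w),
         (f' / f (fst p)) *\<^sub>R (fst u *\<^sub>R snd w + fst w *\<^sub>R snd u))"
      unfolding frechet_derivative_at[OF d, symmetric] using pos
      by (simp add: grw_metric_def inner_simps field_simps power2_eq_square inner_commute)
  qed (auto simp: bilinear_def linear_iff algebra_simps inner_simps inner_commute
      add_divide_distrib)
  show "bilinear (grw_metric f p)"
    by (auto simp: grw_metric_def bilinear_def linear_iff algebra_simps inner_simps)
  show "grw_metric f p v w = grw_metric f p w v" for v w
    by (simp add: grw_metric_def inner_commute)
  show "v = 0" if "\<And>w. grw_metric f p v w = 0" for v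
    using that[of "(- fst v, snd v)"] pos
    by (cases v) (auto simp: grw_metric_def add_nonneg_eq_0_iff zero_prod_def)
qed


section \<open>Spacelike hypersurfaces and their mean curvature\<close>

text \<open>Here \<open>F\<close> is a local parametrization of the hypersurface, \<open>DF\<close> its differential, and \<open>Y\<close>
  a vector field along \<open>F\<close>.\<close>

abbreviation diff_at ::
  "(real ^ 'n \<Rightarrow> 'n spacetime) \<Rightarrow> real ^ 'n \<Rightarrow> real ^ 'n \<Rightarrow> ('n::finite) spacetime" where
  "diff_at F x \<equiv> frechet_derivative F (at x)"

definition cov_deriv_along ::
  "('n spacetime \<Rightarrow> 'n spacetime \<Rightarrow> 'n spacetime \<Rightarrow> real) \<Rightarrow> (real ^ 'n \<Rightarrow> 'n spacetime) \<Rightarrow>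
   (real ^ 'n \<Rightarrow> 'n spacetime) \<Rightarrow> real ^ 'n \<Rightarrow> real ^ 'n \<Rightarrow> ('n::finite) spacetime" where
  "cov_deriv_along g F Y x v =
     frechet_derivative Y (at x) v + christoffel g (F x) (diff_at F x v) (Y x)"

text \<open>A timelike vector has the time-orientation of \<open>\<partial>\<^sub>t\<close> iff its product with \<open>\<partial>\<^sub>t\<close> is
  negative.\<close>

definition unit_normal ::
  "('n spacetime \<Rightarrow> 'n spacetime \<Rightarrow> 'n spacetime \<Rightarrow> real) \<Rightarrow> (real ^ 'n \<Rightarrow> 'n spacetime) \<Rightarrow>
   real ^ 'n \<Rightarrow> ('n::finite) spacetime" where
  "unit_normal g F x =
     (THE \<nu>. g (F x) \<nu> \<nu> = -1 \<and> (\<forall>v. g (F x) \<nu> (diff_at F x v) = 0) \<and>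
             g (F x) \<nu> time_field < 0)"

text \<open>The shape operator in the coordinates of \<open>F\<close>: \<open>DF(A v) = - \<nabla>\<^sub>v N\<close>.\<close>

definition shape_operator ::
  "('n spacetime \<Rightarrow> 'n spacetime \<Rightarrow> 'n spacetime \<Rightarrow> real) \<Rightarrow> (real ^ 'n \<Rightarrow> 'n spacetime) \<Rightarrow>
   real ^ 'n \<Rightarrow> real ^ 'n \<Rightarrow> real ^ ('n::finite)" where
  "shape_operator g F x v =
     (THE w. diff_at F x w = - cov_deriv_along g F (unit_normal g F) x v)"

definition mean_curvature ::
  "('n spacetime \<Rightarrow> 'n spacetime \<Rightarrow> 'n spacetime \<Rightarrow> real) \<Rightarrow>
   (real ^ ('n::finite) \<Rightarrow> 'n spacetime) \<Rightarrow> real ^ 'n \<Rightarrow> real" where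
  "mean_curvature g F x = - (1 / real CARD('n)) * trace (matrix (shape_operator g F x))"

definition induced_metric ::
  "('n spacetime \<Rightarrow> 'n spacetime \<Rightarrow> 'n spacetime \<Rightarrow> real) \<Rightarrow> ('a \<Rightarrow> ('n::finite) spacetime) \<Rightarrow>
   ('a, 'n) metric_tensor" where
  "induced_metric g \<psi> c p v w =
     g (\<psi> p) (diff_at (\<psi> \<circ> chart_inv c) (chart_map c p) v)
             (diff_at (\<psi> \<circ> chart_inv c) (chart_map c p) w)"

definition immersion ::
  "('a, 'n) chart set \<Rightarrow> ('a \<Rightarrow> ('n::finite) spacetime) \<Rightarrow> bool" where
  "immersion A \<psi> \<longleftrightarrow>
     (\<forall>c\<in>A. smooth_on (\<psi> \<circ> chart_inv c) (chart_im c) \<and>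
        (\<forall>x\<in>chart_im c. inj (diff_at (\<psi> \<circ> chart_inv c) x)))"

definition spacelike_hypersurface ::
  "('n spacetime set) \<Rightarrow> ('n spacetime \<Rightarrow> 'n spacetime \<Rightarrow> 'n spacetime \<Rightarrow> real) \<Rightarrow>
   'a topology \<Rightarrow> ('a, 'n) chart set \<Rightarrow> ('a \<Rightarrow> ('n::finite) spacetime) \<Rightarrow> bool" where
  "spacelike_hypersurface \<Omega> g M A \<psi> \<longleftrightarrow>
     smooth_manifold M A \<and> \<psi> ` topspace M \<subseteq> \<Omega> \<and> immersion A \<psi> \<and>
     (\<forall>c\<in>A. \<forall>p\<in>chart_dom c. \<forall>v. v \<noteq> 0 \<longrightarrow> induced_metric g \<psi> c p v v > 0)"

definition complete_hypersurface ::
  "('n spacetime \<Rightarrow> 'n spacetime \<Rightarrow> 'n spacetime \<Rightarrow> real) \<Rightarrow>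
   'a topology \<Rightarrow> ('a, 'n) chart set \<Rightarrow> ('a \<Rightarrow> ('n::finite) spacetime) \<Rightarrow> bool" where
  "complete_hypersurface g M A \<psi> \<longleftrightarrow> complete_riemannian M A (induced_metric g \<psi>)"

definition maximal_hypersurface ::
  "('n spacetime \<Rightarrow> 'n spacetime \<Rightarrow> 'n spacetime \<Rightarrow> real) \<Rightarrow>
   ('a, 'n) chart set \<Rightarrow> ('a \<Rightarrow> ('n::finite) spacetime) \<Rightarrow> bool" where
  "maximal_hypersurface g A \<psi> \<longleftrightarrow>
     (\<forall>c\<in>A. \<forall>x\<in>chart_im c. mean_curvature g (\<psi> \<circ> chart_inv c) x = 0)"

definition bounded_away_from_future_infinity ::
  "'a topology \<Rightarrow> ('a \<Rightarrow> ('n::finite) spacetime) \<Rightarrow> bool" where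
  "bounded_away_from_future_infinity M \<psi> \<longleftrightarrow> bdd_above ((fst \<circ> \<psi>) ` topspace M)"

end

theory Submission
  imports Defs
begin

text \<open>Write \<open>\<psi> = (\<tau>, X)\<close> and \<open>\<eta> = 3 \<tau>\<^bsup>1/3\<^esup>\<close> for the conformal time. Since the hypersurface is
  spacelike, \<open>X\<close> is a local diffeomorphism onto \<open>\<real>\<^sup>n\<close>, and since \<open>f \<circ> \<tau>\<close> is bounded, lifting a
  segment of \<open>\<real>\<^sup>n\<close> stretches lengths at most by a constant factor. Completeness therefore lets
  lifts be continued to every ball, so the hypersurface contains the graph of a positive bounded
  function \<open>\<eta>\<close> over an arbitrarily large ball around \<open>a\<close>. For small \<open>\<epsilon>\<close> the function
  \<open>\<eta> + \<epsilon> |x - a|\<^sup>2\<close> has an interior minimum. There the gradient of \<open>\<eta>\<close> is small and its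
  Hessian is at least \<open>-2 \<epsilon>\<close>, whereas \<open>f' = 2 / \<eta>\<close> is bounded below; this makes the second
  fundamental form definite, so the mean curvature cannot vanish.\<close>

section \<open>Linear algebra and calculus\<close>

text \<open>With d\<eta> = dt / f the metric becomes f^2 (-d\<eta>^2 + dx^2), so spacelike means
  that \<eta>, seen as a function on the slice, has gradient shorter than 1. The decisive feature of
  the model is that conformal time is finite at the big bang: below a fixed time \<eta> stays in a
  bounded interval, and a bounded function on a large ball is given an interior minimum by adding a
  shallow paraboloid. The obstacle is that M is an abstract manifold, not known to be a graph, and
  that completeness refers to a distance defined as an infimum of lengths. Two opposite estimates
  are therefore needed. Lifts of segments are not too long, which produces Cauchy sequences; curves
  leaving a small neighbourhood are not too short, which turns a limit for the distance into a limit
  in the topology of M. No covering theory is invoked: sections are built only over balls around one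
  point and glued by uniqueness on convex overlaps.\<close>

definition cramer_solve :: "real^'n^'n \<Rightarrow> real^'n \<Rightarrow> real^('n::finite)" where
  "cramer_solve A b = (\<chi> k. det (\<chi> i j. if j = k then b$i else A$i$j) / det A)"

lemma cramer_solve: "det A \<noteq> 0 \<Longrightarrow> A *v x = b \<longleftrightarrow> x = cramer_solve A b"
  unfolding cramer_solve_def by (rule cramer)

lemma differentiable_prod:
  fixes f :: "'i \<Rightarrow> 'a::real_normed_vector \<Rightarrow> real"
  assumes "\<And>i. i \<in> I \<Longrightarrow> f i differentiable (at x within S)"
  shows "(\<lambda>y. \<Prod>i\<in>I. f i y) differentiable (at x within S)"
  using assms
  by (induction I rule: infinite_finite_induct) (auto intro!: differentiable_mult)

lemma differentiable_det:
  fixes A :: "'a::real_normed_vector \<Rightarrow> real^'n^('n::finite)"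
  assumes "\<And>i j. (\<lambda>y. A y $ i $ j) differentiable (at x within S)"
  shows "(\<lambda>y. det (A y)) differentiable (at x within S)"
  unfolding det_def
  by (intro differentiable_sum ballI differentiable_mult differentiable_prod differentiable_const assms)
    (simp add: finite_permutations)

lemma differentiable_vec_lambda:
  fixes f :: "'a::real_normed_vector \<Rightarrow> 'n::finite \<Rightarrow> real"
  assumes "\<And>i. (\<lambda>y. f y i) differentiable (at x within S)"
  shows "(\<lambda>y. \<chi> i. f y i) differentiable (at x within S)"
  using assms by (subst differentiable_componentwise_within) (auto simp: Basis_vec_def inner_axis)

lemma differentiable_vec_nth:
  fixes f :: "'a::real_normed_vector \<Rightarrow> real^('n::finite)"
  assumes "f differentiable (at x within S)"
  shows "(\<lambda>y. f y $ i) differentiable (at x within S)"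
  using assms bounded_linear.has_derivative[OF bounded_linear_vec_nth]
  unfolding differentiable_def by blast

text \<open>The quotient of determinants makes the dependence of a solution on its coefficients
  explicit. This gives differentiability of the gradient of \<eta> and, later, continuity of the
  coordinate velocity of a lifted segment.\<close>

lemma differentiable_cramer_solve:
  fixes A :: "'a::real_normed_vector \<Rightarrow> real^'n^('n::finite)"
  assumes A: "\<And>i j. (\<lambda>y. A y $ i $ j) differentiable (at x within S)"
    and b: "\<And>i. (\<lambda>y. b y $ i) differentiable (at x within S)"
    and det: "det (A x) \<noteq> 0"
  shows "(\<lambda>y. cramer_solve (A y) (b y)) differentiable (at x within S)"
  unfolding cramer_solve_def
proof (intro differentiable_vec_lambda differentiable_divide differentiable_det det A)
  fix k i j
  show "(\<lambda>y. (\<chi> i j. if j = k then b y $ i else A y $ i $ j) $ i $ j) differentiable (at x within S)"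
    using A b by (cases "j = k") simp_all
qed


lemma transpose_matrix_mult_component:
  fixes L :: "real^'n \<Rightarrow> real^('n::finite)"
  shows "transpose (matrix L) *v p = (\<chi> i. p \<bullet> L (axis i 1))"
  by (simp add: vec_eq_iff matrix_vector_mult_def transpose_def matrix_def inner_vec_def mult.commute)

text \<open>Cyclicity of the trace. With \<open>L\<close> the spatial part of the differential and
  \<open>K\<close> its inverse, it moves the shape operator from chart coordinates to the slice,
  where the induced metric has an explicit form.\<close>

lemma trace_matrix_conj:
  fixes B L K :: "real^'n \<Rightarrow> real^('n::finite)"
  assumes "linear B" "linear L" "linear K" "\<And>x. L (K x) = x" "\<And>v. A v = K (B v)"
  shows "trace (matrix A) = trace (matrix (\<lambda>x. B (K x)))"
proof -
  have "A = K \<circ> B" using assms(5) by auto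
  then have "matrix A = matrix K ** matrix B" using assms by (simp add: matrix_compose)
  moreover have "matrix (\<lambda>x. B (K x)) = matrix B ** matrix K"
    using matrix_compose[of K B] assms by (simp add: o_def)
  ultimately show ?thesis by (metis trace_mul_sym)
qed

text \<open>The bilinear form \<open>\<langle>\<xi>, \<zeta>\<rangle> - \<langle>\<xi>, p\<rangle>\<langle>p, \<zeta>\<rangle>\<close> is, up to the conformal factor, the induced
  metric in graph coordinates; its inverse is \<open>1 + p p\<^sup>T / (1 - |p|\<^sup>2)\<close>.\<close>

lemma trace_neg:
  fixes B :: "real^'n \<Rightarrow> real^('n::finite)"
  assumes lin: "linear B" and p: "p \<bullet> p < 1"
    and neg: "\<And>\<xi>. \<xi> \<noteq> 0 \<Longrightarrow> B \<xi> \<bullet> \<xi> - (B \<xi> \<bullet> p) * (p \<bullet> \<xi>) < 0"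
  shows "trace (matrix B) < 0"
proof -
  define b where "b \<xi> \<zeta> = B \<xi> \<bullet> \<zeta> - (B \<xi> \<bullet> p) * (p \<bullet> \<zeta>)" for \<xi> \<zeta>
  let ?e = "\<lambda>i::'n. axis i (1::real)"
  have e: "(\<Sum>i\<in>UNIV. (p $ i) *\<^sub>R ?e i) = p"
    using basis_expansion[of p] by (simp add: scalar_mult_eq_scaleR)
  have "(\<Sum>i\<in>UNIV. (B (?e i) \<bullet> p) * (p $ i)) = B (\<Sum>i\<in>UNIV. (p $ i) *\<^sub>R ?e i) \<bullet> p"
    by (simp add: linear_sum[OF lin] linear_cmul[OF lin] inner_sum_left mult.commute)
  then have 1: "(\<Sum>i\<in>UNIV. (B (?e i) \<bullet> p) * (p $ i)) = B p \<bullet> p" by (simp add: e)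
  have "trace (matrix B) = (\<Sum>i\<in>UNIV. B (?e i) \<bullet> ?e i)"
    by (simp add: trace_def matrix_def inner_axis)
  also have "\<dots> = (\<Sum>i\<in>UNIV. b (?e i) (?e i)) + B p \<bullet> p"
    by (simp add: b_def sum_subtractf 1 inner_axis)
  finally have tr: "trace (matrix B) = (\<Sum>i\<in>UNIV. b (?e i) (?e i)) + B p \<bullet> p" .
  have "(\<Sum>i\<in>UNIV. b (?e i) (?e i)) < (\<Sum>i\<in>(UNIV::'n set). 0)"
    by (rule sum_strict_mono) (use neg in \<open>auto simp: b_def axis_eq_0_iff\<close>)
  moreover have "B p \<bullet> p \<le> 0"
  proof (cases "p = 0")
    case False
    \<comment> \<open>The form takes the value (1 - |p|^2) <B p, p> on the pair (p, p), so its
      negativity at p fixes the sign of the rank-one correction to the Euclidean trace.\<close>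
    have "(B p \<bullet> p) * (1 - p \<bullet> p) < 0" using neg[OF False] by (simp add: algebra_simps)
    then show ?thesis using p by (simp add: mult_less_0_iff)
  qed simp
  ultimately show ?thesis using tr by simp
qed

lemma has_vector_derivative_line:
  fixes G :: "'a::real_normed_vector \<Rightarrow> 'b::real_normed_vector"
  assumes "(G has_derivative G') (at (y + t *\<^sub>R v))"
  shows "((\<lambda>t. G (y + t *\<^sub>R v)) has_vector_derivative G' v) (at t)"
proof -
  have "((\<lambda>t. y + t *\<^sub>R v) has_derivative (\<lambda>s. s *\<^sub>R v)) (at t)"
    by (auto intro!: derivative_eq_intros)
  from has_derivative_compose[OF this assms]
  have "((\<lambda>t. G (y + t *\<^sub>R v)) has_derivative (\<lambda>s. G' (s *\<^sub>R v))) (at t)" .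
  then show ?thesis
    using linear_cmul[OF has_derivative_linear[OF assms]] by (simp add: has_vector_derivative_def)
qed

text \<open>If \<open>k\<close> were negative, \<open>h'\<close> would be negative just to the right
  of 0, and the mean value theorem would produce a value of \<open>h\<close> below the minimum. A
  second derivative at the single point 0 suffices for this.\<close>

lemma local_min_second_derivative:
  fixes h h' :: "real \<Rightarrow> real"
  assumes d: "0 < d" and h: "\<And>t. \<bar>t\<bar> < d \<Longrightarrow> (h has_real_derivative h' t) (at t)"
    and h': "(h' has_real_derivative k) (at 0)" and min: "\<And>t. \<bar>t\<bar> < d \<Longrightarrow> h 0 \<le> h t"
  shows "h' 0 = 0" "0 \<le> k"
proof -
  show z: "h' 0 = 0"
    using DERIV_local_min[OF h[of 0] d] d min by simp
  show "0 \<le> k"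
  proof (rule ccontr)
    assume "\<not> 0 \<le> k"
    then obtain e where e: "e > 0" "\<And>x. 0 < x \<Longrightarrow> x < e \<Longrightarrow> h' (0 + x) < h' 0"
      using DERIV_neg_dec_right[OF h'] by auto
    define t where "t = min d e / 2"
    have t: "0 < t" "t < d" "t < e" using d e by (auto simp: t_def min_def)
    obtain z where z: "0 < z" "z < t" "h t - h 0 = (t - 0) * h' z"
      using MVT2[of 0 t h h'] t h by auto
    have "h' z < 0" using e(2)[of z] z t \<open>h' 0 = 0\<close> by simp
    then have "h t < h 0" using z t by (smt (verit) mult_pos_neg)
    then show False using min[of t] t by simp
  qed
qed

section \<open>Mean curvature of a parametrized spacelike hypersurface\<close>

text \<open>The curvature computation is kept free of charts and topology: \<open>F\<close> will be
  \<open>\<psi>\<close> composed with the inverse of an arbitrary chart.\<close>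

locale grw_param =
  fixes f f' :: "real \<Rightarrow> real" and S :: "(real^('n::finite)) set" and F :: "real^'n \<Rightarrow> 'n spacetime"
  assumes open_S: "open S" and smooth: "Ck_on 2 F S"
    and f_pos: "\<And>y. y \<in> S \<Longrightarrow> 0 < f (fst (F y))"
    and f_deriv: "\<And>y. y \<in> S \<Longrightarrow> (f has_real_derivative f' (fst (F y))) (at (fst (F y)))"
    and spacelike: "\<And>y v. y \<in> S \<Longrightarrow> v \<noteq> 0 \<Longrightarrow>
      0 < grw_metric f (F y) (diff_at F y v) (diff_at F y v)"
begin

abbreviation DT where "DT y v \<equiv> fst (diff_at F y v)"
abbreviation DX where "DX y v \<equiv> snd (diff_at F y v)"
abbreviation D2 where "D2 y v w \<equiv> frechet_derivative (\<lambda>z. diff_at F z w) (at y) v"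
abbreviation fF where "fF y \<equiv> f (fst (F y))"
abbreviation fF' where "fF' y \<equiv> f' (fst (F y))"

section \<open>First derivatives of the parametrization and the slope of the hypersurface\<close>

lemma has_derivative: "y \<in> S \<Longrightarrow> (F has_derivative diff_at F y) (at y)"
  using smooth frechet_derivative_works by (auto simp: numeral_2_eq_2)

lemma has_derivative2: "y \<in> S \<Longrightarrow> ((\<lambda>z. diff_at F z w) has_derivative (\<lambda>v. D2 y v w)) (at y)"
  using smooth by (simp add: numeral_2_eq_2 frechet_derivative_works[symmetric])

lemma linear: "y \<in> S \<Longrightarrow> linear (diff_at F y)"
  using has_derivative has_derivative_linear by blast

lemma linear_DX: "y \<in> S \<Longrightarrow> linear (DX y)"
  using linear_compose[OF linear, of y snd] linear_snd by (simp add: o_def)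

lemma linear_DT: "y \<in> S \<Longrightarrow> linear (DT y)"
  using linear_compose[OF linear, of y fst] linear_fst by (simp add: o_def)

text \<open>A tangent vector without spatial part has Lorentzian square -(DT)^2, which is never
  positive. Here spacelikeness turns the spatial projection into a local diffeomorphism.\<close>

lemma DX_eq_0: "y \<in> S \<Longrightarrow> DX y v = 0 \<Longrightarrow> v = 0"
  using spacelike[of y v] by (fastforce simp: grw_metric_def)

lemma inj_DX: "y \<in> S \<Longrightarrow> inj (DX y)"
  using linear_injective_0[OF linear_DX] DX_eq_0 by blast

lemma det_DX: "y \<in> S \<Longrightarrow> det (matrix (DX y)) \<noteq> 0"
  using det_nz_iff_inj[OF linear_DX] inj_DX by blast

lemma surj_DX: "y \<in> S \<Longrightarrow> surj (DX y)"
  using linear_injective_imp_surjective[OF linear_DX] inj_DX by blast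

text \<open>The Euclidean gradient of the conformal time, as a function on the spatial slice.\<close>

definition slope :: "real^'n \<Rightarrow> real^'n" where
  "slope y = cramer_solve (transpose (matrix (DX y))) (\<chi> i. DT y (axis i 1) / fF y)"

lemma DT_eq:
  assumes y: "y \<in> S" shows "DT y v = fF y * (slope y \<bullet> DX y v)"
proof -
  have "transpose (matrix (DX y)) *v slope y = (\<chi> i. DT y (axis i 1) / fF y)"
    using cramer_solve[of "transpose (matrix (DX y))"] det_DX[OF y]
    by (simp add: slope_def det_transpose)
  then have "slope y \<bullet> DX y (axis i 1) = DT y (axis i 1) / fF y" for i
    unfolding transpose_matrix_mult_component by (simp add: vec_eq_iff)
  then have b: "DT y (axis i 1) = fF y * (slope y \<bullet> DX y (axis i 1))" for i
    using f_pos[OF y] by simp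
  have "linear (\<lambda>v. fF y * (slope y \<bullet> DX y v))"
    using linear_DX[OF y] by (auto simp: linear_iff inner_simps algebra_simps)
  from linear_eq_stdbasis[OF linear_DT[OF y] this] show ?thesis
    using b by (force simp: Basis_vec_def dest: fun_cong)
qed

lemma differentiable_slope:
  assumes y: "y \<in> S" shows "slope differentiable (at y)"
proof -
  have D: "(\<lambda>z. diff_at F z v) differentiable (at y)" for v
    using has_derivative2[OF y] differentiable_def by blast
  have DX: "(\<lambda>z. DX z v) differentiable (at y)" for v
    using has_derivative_snd[OF has_derivative2[OF y]] unfolding differentiable_def by blast
  have DT: "(\<lambda>z. DT z v) differentiable (at y)" for v
    using has_derivative_fst[OF has_derivative2[OF y]] unfolding differentiable_def by blast
  have f: "fF differentiable (at y)"
    using has_derivative_compose[OF has_derivative_fst[OF has_derivative[OF y]]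
        f_deriv[OF y, unfolded has_field_derivative_def]]
    unfolding differentiable_def by blast
  show ?thesis
    unfolding slope_def[abs_def]
  proof (rule differentiable_cramer_solve)
    show "det (transpose (matrix (DX y))) \<noteq> 0" using det_DX[OF y] by (simp add: det_transpose)
    show "(\<lambda>z. transpose (matrix (DX z)) $ i $ j) differentiable (at y)" for i j
      using differentiable_vec_nth[OF DX] by (simp add: transpose_def matrix_def)
    show "(\<lambda>z. (\<chi> i. DT z (axis i 1) / fF z) $ i) differentiable (at y)" for i
      using f_pos[OF y] by (simp, intro differentiable_divide DT f) auto
  qed
qed

text \<open>Substituting DT = f <p, DX> shows that the induced metric is f^2 (1 - p p^T) in terms of
  the spatial parts. This is the form for which \<open>trace_neg\<close> is made.\<close>

lemma metric_diff:
  assumes y: "y \<in> S"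
  shows "grw_metric f (F y) (diff_at F y v) (diff_at F y w)
    = (fF y)\<^sup>2 * (DX y v \<bullet> DX y w - (slope y \<bullet> DX y v) * (slope y \<bullet> DX y w))"
  unfolding grw_metric_def DT_eq[OF y] by (simp add: algebra_simps power2_eq_square)

text \<open>Spacelikeness is tested on the tangent vector whose spatial part is the slope p itself;
  its square is f^2 |p|^2 (1 - |p|^2).\<close>

lemma slope_less_1:
  assumes y: "y \<in> S" shows "slope y \<bullet> slope y < 1"
proof (cases "slope y = 0")
  case False
  obtain v where v: "DX y v = slope y" using surj_DX[OF y] by (metis surjD)
  with False have "v \<noteq> 0" using linear_0[OF linear_DX[OF y]] by auto
  have "0 < (fF y)\<^sup>2 * (slope y \<bullet> slope y * (1 - slope y \<bullet> slope y))"
    using spacelike[OF y \<open>v \<noteq> 0\<close>] unfolding metric_diff[OF y] v by (simp add: algebra_simps)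
  moreover have "0 < slope y \<bullet> slope y" using False by simp
  ultimately show ?thesis by (simp add: zero_less_mult_iff del: inner_gt_zero_iff)
qed simp

lemma slope_eqI:
  assumes y: "y \<in> S" and "\<And>v. DT y v = fF y * (q \<bullet> DX y v)"
  shows "slope y = q"
proof -
  obtain v where v: "DX y v = slope y - q" using surj_DX[OF y] by (metis surjD)
  have "fF y * ((slope y - q) \<bullet> DX y v) = 0"
    using assms(2)[of v] DT_eq[OF y, of v] by (simp add: algebra_simps inner_simps)
  then show ?thesis using f_pos[OF y] by (simp add: v)
qed

text \<open>The vector (1, p / f) is orthogonal to every tangent vector (f <p, \<xi>>, \<xi>) and
  has square -(1 - |p|^2); the square root normalises it.\<close>

definition normal :: "real^'n \<Rightarrow> 'n spacetime" where
  "normal y = (1 / sqrt (1 - slope y \<bullet> slope y), (1 / (sqrt (1 - slope y \<bullet> slope y) * fF y)) *\<^sub>R slope y)"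

lemma normal_props:
  assumes y: "y \<in> S"
  shows "grw_metric f (F y) (normal y) (normal y) = -1"
    and "grw_metric f (F y) (normal y) (diff_at F y v) = 0"
    and "grw_metric f (F y) (normal y) time_field < 0"
proof -
  define s where "s = sqrt (1 - slope y \<bullet> slope y)"
  have s: "s > 0" and ss: "slope y \<bullet> slope y = 1 - s\<^sup>2" using slope_less_1[OF y] by (auto simp: s_def)
  have N: "normal y = (1 / s, (1 / (s * fF y)) *\<^sub>R slope y)" by (simp add: normal_def s_def)
  show "grw_metric f (F y) (normal y) (normal y) = -1"
    using s f_pos[OF y] by (simp add: grw_metric_def N ss power2_eq_square) (simp add: field_simps)
  show "grw_metric f (F y) (normal y) (diff_at F y v) = 0"
    using s f_pos[OF y] by (simp add: grw_metric_def N DT_eq[OF y] power2_eq_square)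
  show "grw_metric f (F y) (normal y) time_field < 0"
    using s by (simp add: grw_metric_def N time_field_def)
qed

lemma unit_normal_eq:
  assumes y: "y \<in> S" shows "unit_normal (grw_metric f) F y = normal y"
  unfolding unit_normal_def
proof (rule the_equality)
  fix \<nu> :: "'n spacetime"
  assume \<nu>: "grw_metric f (F y) \<nu> \<nu> = -1 \<and> (\<forall>v. grw_metric f (F y) \<nu> (diff_at F y v) = 0) \<and>
             grw_metric f (F y) \<nu> time_field < 0"
  obtain a b where ab: "\<nu> = (a, b)" by (cases \<nu>)
  have a: "a > 0" using \<nu> by (simp add: ab grw_metric_def time_field_def)
  \<comment> \<open>Orthogonality to the hypersurface says that f b - a p is orthogonal to all
    spatial parts. Choosing the tangent vector whose spatial part is this very vector forces it to
    vanish.\<close>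
  obtain v where v: "DX y v = fF y *\<^sub>R b - a *\<^sub>R slope y" using surj_DX[OF y] by (metis surjD)
  have "grw_metric f (F y) \<nu> (diff_at F y v) = 0" using \<nu> by blast
  then have "fF y * ((fF y *\<^sub>R b - a *\<^sub>R slope y) \<bullet> DX y v) = 0"
    by (simp add: ab grw_metric_def DT_eq[OF y] inner_simps algebra_simps power2_eq_square)
  then have "fF y *\<^sub>R b = a *\<^sub>R slope y" using f_pos[OF y] by (simp add: v)
  then have "(1 / fF y) *\<^sub>R (fF y *\<^sub>R b) = (1 / fF y) *\<^sub>R (a *\<^sub>R slope y)" by simp
  then have b: "b = (a / fF y) *\<^sub>R slope y" using f_pos[OF y] by simp
  have "a\<^sup>2 * (1 - slope y \<bullet> slope y) = 1"
    using \<nu> f_pos[OF y] unfolding ab b grw_metric_def by (simp add: power2_eq_square algebra_simps)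
  then have "(a * sqrt (1 - slope y \<bullet> slope y))\<^sup>2 = 1" using slope_less_1[OF y]
    by (simp add: power_mult_distrib)
  then have "a * sqrt (1 - slope y \<bullet> slope y) = 1" using a slope_less_1[OF y]
    by (smt (verit) power2_eq_1_iff mult_nonneg_nonneg real_sqrt_ge_zero)
  then have "a = 1 / sqrt (1 - slope y \<bullet> slope y)"
    using slope_less_1[OF y] by (simp add: field_simps)
  then show "\<nu> = normal y" by (simp add: ab b normal_def)
qed (use normal_props[OF y] in auto)

section \<open>Covariant derivative of the normal and the second fundamental form\<close>

lemma has_derivative_fF:
  assumes y: "y \<in> S" shows "(fF has_derivative (\<lambda>v. fF' y * DT y v)) (at y)"
  using has_derivative_compose[OF has_derivative_fst[OF has_derivative[OF y]]
      f_deriv[OF y, unfolded has_field_derivative_def]] .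

lemma differentiable_normal:
  assumes y: "y \<in> S" shows "normal differentiable (at y)"
proof -
  obtain p' where p': "(slope has_derivative p') (at y)"
    using differentiable_slope[OF y] unfolding differentiable_def by blast
  have "(\<lambda>z. 1 - slope z \<bullet> slope z) differentiable (at y)"
    using p' by (intro differentiableI) (auto intro!: derivative_eq_intros)
  then obtain q' where q: "((\<lambda>z. 1 - slope z \<bullet> slope z) has_derivative q') (at y)"
    unfolding differentiable_def by blast
  have "((\<lambda>z. sqrt (1 - slope z \<bullet> slope z)) has_derivative
      (\<lambda>v. q' v * (inverse (sqrt (1 - slope y \<bullet> slope y)) / 2))) (at y)"
    using has_derivative_real_sqrt[OF _ q] slope_less_1[OF y] by simp
  then have s: "(\<lambda>z. sqrt (1 - slope z \<bullet> slope z)) differentiable (at y)"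
    unfolding differentiable_def by blast
  have s0: "sqrt (1 - slope y \<bullet> slope y) \<noteq> 0" using slope_less_1[OF y] by simp
  have 1: "(\<lambda>z. 1 / sqrt (1 - slope z \<bullet> slope z)) differentiable (at y)"
    by (intro differentiable_divide s s0 differentiable_const)
  have f: "fF differentiable (at y)" using has_derivative_fF[OF y] differentiableI by blast
  have 2: "(\<lambda>z. 1 / (sqrt (1 - slope z \<bullet> slope z) * fF z)) differentiable (at y)"
    using s0 f_pos[OF y] by (intro differentiable_divide differentiable_mult s f differentiable_const) auto
  have 3: "(\<lambda>z. (1 / (sqrt (1 - slope z \<bullet> slope z) * fF z)) *\<^sub>R slope z) differentiable (at y)"
    by (rule differentiable_scaleR[OF 2 differentiable_slope[OF y]])
  from 1 3 show ?thesis
    unfolding normal_def[abs_def] differentiable_def by (elim exE) (rule exI, rule has_derivative_Pair)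
qed

text \<open>The covariant derivative of the normal with the Christoffel symbols of the warped
  product written out, so that no description operator remains in the later computations.\<close>

definition covN :: "real^'n \<Rightarrow> real^'n \<Rightarrow> 'n spacetime" where
  "covN y v = (fst (frechet_derivative normal (at y) v) + fF y * fF' y * (DX y v \<bullet> snd (normal y)),
     snd (frechet_derivative normal (at y) v) +
       (fF' y / fF y) *\<^sub>R (DT y v *\<^sub>R snd (normal y) + fst (normal y) *\<^sub>R DX y v))"

lemma has_derivative_normal:
  "y \<in> S \<Longrightarrow> (normal has_derivative frechet_derivative normal (at y)) (at y)"
  using differentiable_normal frechet_derivative_works by blast

lemma cov_deriv_normal:
  assumes y: "y \<in> S"
  shows "cov_deriv_along (grw_metric f) F (unit_normal (grw_metric f) F) y v = covN y v"
proof -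
  have "(unit_normal (grw_metric f) F has_derivative frechet_derivative normal (at y)) (at y)"
    by (rule has_derivative_transform_within_open[OF has_derivative_normal[OF y] open_S y])
      (simp add: unit_normal_eq)
  then have "frechet_derivative (unit_normal (grw_metric f) F) (at y) = frechet_derivative normal (at y)"
    using frechet_derivative_at by metis
  then show ?thesis
    unfolding cov_deriv_along_def covN_def unit_normal_eq[OF y]
      christoffel_grw[OF f_deriv[OF y] f_pos[OF y]]
    by (simp add: prod_eq_iff)
qed

lemma linear_covN:
  assumes y: "y \<in> S" shows "linear (\<lambda>v. snd (covN y v))"
proof -
  have l: "linear (frechet_derivative normal (at y))"
    using has_derivative_linear[OF has_derivative_normal[OF y]] .
  show ?thesis
    using l linear_DX[OF y] linear_DT[OF y]
    by (auto simp: covN_def linear_iff algebra_simps add_divide_distrib)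
qed

lemma constant_derivative_0:
  fixes h :: "real^'n \<Rightarrow> real"
  assumes y: "y \<in> S" and h: "(h has_derivative h') (at y)" and c: "\<And>z. z \<in> S \<Longrightarrow> h z = c"
  shows "h' v = 0"
proof -
  have "((\<lambda>_. c) has_derivative h') (at y)"
    by (rule has_derivative_transform_within_open[OF h open_S y]) (simp add: c)
  then have "h' = (\<lambda>_. 0)" using has_derivative_unique has_derivative_const by blast
  then show ?thesis by simp
qed

text \<open>Differentiate g(N, N) = -1. The derivative of f^2 supplies exactly the Christoffel terms
  that survive in g(covN, N), so metric compatibility is verified by direct computation.\<close>

lemma covN_normal:
  assumes y: "y \<in> S" shows "grw_metric f (F y) (covN y v) (normal y) = 0"
proof -
  let ?N = "frechet_derivative normal (at y)"
  have "((\<lambda>z. grw_metric f (F z) (normal z) (normal z)) has_derivative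
     (\<lambda>v. - (2 * fst (normal y) * fst (?N v)) + (2 * fF y * (fF' y * DT y v)) * (snd (normal y) \<bullet> snd (normal y))
       + (fF y)\<^sup>2 * (2 * (snd (normal y) \<bullet> snd (?N v))))) (at y)"
    unfolding grw_metric_def
    by (rule derivative_eq_intros refl has_derivative_fF[OF y] has_derivative_normal[OF y])+
      (auto simp: inner_commute algebra_simps)
  from constant_derivative_0[OF y this normal_props(1)]
  have "- (2 * fst (normal y) * fst (?N v)) + (2 * fF y * (fF' y * DT y v)) * (snd (normal y) \<bullet> snd (normal y))
       + (fF y)\<^sup>2 * (2 * (snd (normal y) \<bullet> snd (?N v))) = 0" .
  then show ?thesis
    using f_pos[OF y]
    by (simp add: grw_metric_def covN_def inner_simps power2_eq_square inner_commute algebra_simps)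
qed

text \<open>Differentiating g(N, DF w) = 0 shifts the derivative from the normal to
  \<open>F\<close>: the right-hand side is -g(N, Z), where Z is the covariant derivative of DF w in
  direction v. Thus the second fundamental form is expressed by second derivatives of
  \<open>F\<close> alone.\<close>

lemma covN_tangent:
  assumes y: "y \<in> S"
  shows "grw_metric f (F y) (covN y v) (diff_at F y w) =
    fst (normal y) * (fst (D2 y v w) + fF y * fF' y * (DX y v \<bullet> DX y w)) -
    (fF y)\<^sup>2 * (snd (normal y) \<bullet> (snd (D2 y v w) +
      (fF' y / fF y) *\<^sub>R (DT y v *\<^sub>R DX y w + DT y w *\<^sub>R DX y v)))"
proof -
  let ?N = "frechet_derivative normal (at y)"
  have "((\<lambda>z. grw_metric f (F z) (normal z) (diff_at F z w)) has_derivative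
     (\<lambda>v. - (fst (?N v) * DT y w + fst (normal y) * fst (D2 y v w)) +
       (2 * fF y * (fF' y * DT y v)) * (snd (normal y) \<bullet> DX y w)
       + (fF y)\<^sup>2 * (snd (?N v) \<bullet> DX y w + snd (normal y) \<bullet> snd (D2 y v w)))) (at y)"
    unfolding grw_metric_def
    by (rule derivative_eq_intros refl has_derivative_fF[OF y] has_derivative_normal[OF y] has_derivative2[OF y])+
      (auto simp: inner_commute algebra_simps)
  from constant_derivative_0[OF y this normal_props(2)]
  have "- (fst (?N v) * DT y w + fst (normal y) * fst (D2 y v w)) +
       (2 * fF y * (fF' y * DT y v)) * (snd (normal y) \<bullet> DX y w)
       + (fF y)\<^sup>2 * (snd (?N v) \<bullet> DX y w + snd (normal y) \<bullet> snd (D2 y v w)) = 0" .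
  then show ?thesis
    using f_pos[OF y]
    by (simp add: grw_metric_def covN_def inner_simps power2_eq_square inner_commute algebra_simps)
qed

text \<open>The hypothesis says that the second fundamental form is negative definite.\<close>

lemma mean_curvature_pos:
  assumes y: "y \<in> S"
    and E: "\<And>v. v \<noteq> 0 \<Longrightarrow> 0 < fst (D2 y v v) - fF y * (slope y \<bullet> snd (D2 y v v)) +
      fF y * fF' y * (DX y v \<bullet> DX y v - 2 * (slope y \<bullet> DX y v)\<^sup>2)"
  shows "0 < mean_curvature (grw_metric f) F y"
proof -
  let ?p = "slope y"
  define K where "K = inv (DX y)"
  define B where "B v = - snd (covN y v)" for v
  have LK: "DX y (K x) = x" for x unfolding K_def by (rule surj_f_inv_f[OF surj_DX[OF y]])
  have KL: "K (DX y v) = v" for v unfolding K_def by (rule inv_f_f[OF inj_DX[OF y]])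
  have linK: "linear K"
    unfolding K_def by (rule inj_linear_imp_inv_linear[OF linear_DX[OF y] inj_DX[OF y]])
  have linB: "linear B" using linear_covN[OF y] by (auto simp: B_def linear_iff algebra_simps)
  define a where "a = fst (normal y)"
  have a: "a > 0" using slope_less_1[OF y] by (simp add: a_def normal_def)
  have N: "snd (normal y) = (a / fF y) *\<^sub>R ?p" by (simp add: a_def normal_def)
  \<comment> \<open>Orthogonality to N makes the covariant derivative of N tangent, so its time part
    is determined by its spatial part and the shape operator can be read off from spatial
    parts.\<close>
  have time: "fst (covN y v) = fF y * (snd (covN y v) \<bullet> ?p)" for v
  proof -
    have "a * (fst (covN y v) - fF y * (snd (covN y v) \<bullet> ?p)) = 0"
      using covN_normal[OF y, of v] f_pos[OF y]
      by (simp add: grw_metric_def N power2_eq_square algebra_simps flip: a_def) metis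
    then show ?thesis using a by simp
  qed
  have shape: "shape_operator (grw_metric f) F y v = K (B v)" for v
    unfolding shape_operator_def cov_deriv_normal[OF y]
  proof (rule the_equality)
    have "DX y (K (B v)) = - snd (covN y v)" by (simp add: LK B_def)
    moreover from this have "DT y (K (B v)) = - fst (covN y v)"
      by (simp add: DT_eq[OF y] time inner_commute)
    ultimately show "diff_at F y (K (B v)) = - covN y v" by (simp add: prod_eq_iff)
    show "w = K (B v)" if "diff_at F y w = - covN y v" for w
      using KL[of w] that by (simp add: B_def)
  qed
  have "trace (matrix (shape_operator (grw_metric f) F y)) = trace (matrix (\<lambda>x. B (K x)))"
    by (rule trace_matrix_conj[OF linB linear_DX[OF y] linK LK shape])
  also have "\<dots> < 0"
  proof (rule trace_neg)
    show "linear (\<lambda>x. B (K x))" using linear_compose[OF linK linB] by (simp add: o_def)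
    show "?p \<bullet> ?p < 1" by (rule slope_less_1[OF y])
    fix \<xi> :: "real^'n" assume "\<xi> \<noteq> 0"
    define v where "v = K \<xi>"
    have \<xi>: "\<xi> = DX y v" by (simp add: v_def LK)
    have "v \<noteq> 0" using \<open>\<xi> \<noteq> 0\<close> linear_0[OF linear_DX[OF y]] by (auto simp: \<xi>)
    \<comment> \<open>Multiplication by the time part \<open>a\<close> of the normal turns the
      hypothesis \<open>E\<close> into the value of g(covN v, DF v).\<close>
    have "0 < a * (fst (D2 y v v) - fF y * (slope y \<bullet> snd (D2 y v v)) +
      fF y * fF' y * (\<xi> \<bullet> \<xi> - 2 * (slope y \<bullet> \<xi>)\<^sup>2))"
      using E[OF \<open>v \<noteq> 0\<close>] a by (simp add: \<xi>)
    also have "\<dots> = grw_metric f (F y) (covN y v) (diff_at F y v)"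
      unfolding covN_tangent[OF y] N a_def[symmetric] \<xi>[symmetric] DT_eq[OF y] inner_add_right
        inner_scaleR_right inner_scaleR_left using f_pos[OF y]
      by (simp add: power2_eq_square algebra_simps)
    also have "\<dots> = (fF y)\<^sup>2 * (snd (covN y v) \<bullet> \<xi> - (snd (covN y v) \<bullet> ?p) * (?p \<bullet> \<xi>))"
      by (simp add: grw_metric_def time DT_eq[OF y] power2_eq_square algebra_simps flip: \<xi>)
    finally have "0 < snd (covN y v) \<bullet> \<xi> - (snd (covN y v) \<bullet> ?p) * (?p \<bullet> \<xi>)"
      by (simp add: zero_less_mult_iff)
    then show "B (K \<xi>) \<bullet> \<xi> - (B (K \<xi>) \<bullet> ?p) * (?p \<bullet> \<xi>) < 0"
      by (simp add: B_def flip: v_def)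
  qed
  finally show ?thesis
    by (simp add: mean_curvature_def divide_less_0_iff)
qed

text \<open>The first order condition is p = -2 \<epsilon> (X - a), so |p|^2 = 4 \<epsilon>^2 |X -
  a|^2. The second order condition bounds the second derivative terms below by f' <p, \<xi>>^2 - 2
  \<epsilon> |\<xi>|^2, where \<xi> = DX v. Adding f' (|\<xi>|^2 - 2 <p, \<xi>>^2) and using
  Cauchy-Schwarz leaves at least (f' (1 - |p|^2) - 2 \<epsilon>) |\<xi>|^2, which the assumption on
  \<epsilon> makes positive.\<close>

lemma mean_curvature_pos_at_local_min:
  fixes \<eta> :: "real \<Rightarrow> real"
  assumes y: "y \<in> S" and \<epsilon>: "2 * \<epsilon> < fF' y * (1 - 4 * \<epsilon>\<^sup>2 * (norm (snd (F y) - a))\<^sup>2)"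
    and \<epsilon>0: "0 \<le> \<epsilon>"
    and \<eta>: "\<And>z. z \<in> S \<Longrightarrow> (\<eta> has_real_derivative 1 / fF z) (at (fst (F z)))"
    and min: "eventually (\<lambda>z. \<eta> (fst (F y)) + \<epsilon> * (norm (snd (F y) - a))\<^sup>2
      \<le> \<eta> (fst (F z)) + \<epsilon> * (norm (snd (F z) - a))\<^sup>2) (nhds y)"
  shows "0 < mean_curvature (grw_metric f) F y"
proof -
  define \<Phi> where "\<Phi> z = \<eta> (fst (F z)) + \<epsilon> * ((snd (F z) - a) \<bullet> (snd (F z) - a))" for z
  have "eventually (\<lambda>z. z \<in> S \<and> \<Phi> y \<le> \<Phi> z) (nhds y)"
    using eventually_nhds_in_open[OF open_S y] min
    by eventually_elim (simp add: \<Phi>_def power2_norm_eq_inner)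
  then obtain r where r: "r > 0" "\<And>z. dist z y < r \<Longrightarrow> z \<in> S \<and> \<Phi> y \<le> \<Phi> z"
    unfolding eventually_nhds_metric by blast
  define X where "X z = snd (F z) - a" for z
  let ?q = "(- 2 * \<epsilon>) *\<^sub>R X y"
  \<comment> \<open>Both conditions are obtained along straight lines of the parameter domain. The
    parameters need not be graph coordinates, so a second derivative of X appears; the first order
    condition converts its coefficient into the slope.\<close>
  have both: "DT y v / fF y + 2 * \<epsilon> * (X y \<bullet> DX y v) = 0 \<and>
     0 \<le> fst (D2 y v v) / fF y - DT y v * (fF' y * DT y v) / (fF y)\<^sup>2 +
       2 * \<epsilon> * (DX y v \<bullet> DX y v + X y \<bullet> snd (D2 y v v))" if v: "v \<noteq> 0" for v
  proof -
    define d where "d = r / norm v"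
    have d: "d > 0" using r v by (simp add: d_def)
    let ?l = "\<lambda>t::real. y + t *\<^sub>R v"
    have l: "?l t \<in> S" "\<Phi> y \<le> \<Phi> (?l t)" if "\<bar>t\<bar> < d" for t
    proof -
      have "dist (?l t) y < r" using that v by (simp add: d_def dist_norm pos_less_divide_eq)
      then show "?l t \<in> S" "\<Phi> y \<le> \<Phi> (?l t)" using r(2) by auto
    qed
    define h' where "h' t = DT (?l t) v / fF (?l t) + 2 * \<epsilon> * (X (?l t) \<bullet> DX (?l t) v)" for t
    have 1: "((\<lambda>t. \<Phi> (?l t)) has_real_derivative h' t) (at t)" if t: "\<bar>t\<bar> < d" for t
    proof -
      have F: "((\<lambda>t. F (?l t)) has_vector_derivative diff_at F (?l t) v) (at t)"
        by (rule has_vector_derivative_line[OF has_derivative[OF l(1)[OF t]]])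
      have T: "((\<lambda>t. fst (F (?l t))) has_real_derivative DT (?l t) v) (at t)"
        using has_derivative_fst[OF F[unfolded has_vector_derivative_def]]
        by (simp add: has_field_derivative_def mult.commute[of _ "DT _ _"])
      have \<eta>T: "((\<lambda>t. \<eta> (fst (F (?l t)))) has_real_derivative 1 / fF (?l t) * DT (?l t) v) (at t)"
        using DERIV_chain2[OF \<eta>[OF l(1)[OF t]] T] .
      have X: "((\<lambda>t. X (?l t)) has_derivative (\<lambda>s. s *\<^sub>R DX (?l t) v)) (at t)"
        using has_derivative_diff[OF has_derivative_snd[OF F[unfolded has_vector_derivative_def]]
            has_derivative_const[of a]] by (simp add: X_def)
      have "((\<lambda>t. \<Phi> (?l t)) has_derivative (\<lambda>s. s * h' t)) (at t)"
        unfolding \<Phi>_def X_def[symmetric]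
        by (rule derivative_eq_intros refl X \<eta>T[unfolded has_field_derivative_def])+
          (auto simp: h'_def inner_commute algebra_simps)
      then show ?thesis by (simp add: has_field_derivative_def mult.commute[of _ "h' t"])
    qed
    have 2: "(h' has_real_derivative fst (D2 y v v) / fF y - DT y v * (fF' y * DT y v) / (fF y)\<^sup>2 +
       2 * \<epsilon> * (DX y v \<bullet> DX y v + X y \<bullet> snd (D2 y v v))) (at 0)"
    proof -
      have DF: "((\<lambda>t. diff_at F (?l t) v) has_derivative (\<lambda>s. s *\<^sub>R D2 y v v)) (at 0)"
        using has_vector_derivative_line[of "\<lambda>z. diff_at F z v" _ y 0 v] has_derivative2[OF y]
        by (simp add: has_vector_derivative_def)
      have F: "((\<lambda>t. F (?l t)) has_derivative (\<lambda>s. s *\<^sub>R diff_at F y v)) (at 0)"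
        using has_vector_derivative_line[of F _ y 0 v] has_derivative[OF y]
        by (simp add: has_vector_derivative_def)
      have fl: "((\<lambda>t. fF (?l t)) has_derivative (\<lambda>s. s *\<^sub>R (fF' y * DT y v))) (at 0)"
        using has_vector_derivative_line[of fF _ y 0 v] has_derivative_fF[OF y]
        by (simp add: has_vector_derivative_def)
      have X: "((\<lambda>t. X (?l t)) has_derivative (\<lambda>s. s *\<^sub>R DX y v)) (at 0)"
        using has_derivative_diff[OF has_derivative_snd[OF F] has_derivative_const[of a]]
        by (simp add: X_def)
      have "(h' has_derivative (\<lambda>s. s * (fst (D2 y v v) / fF y - DT y v * (fF' y * DT y v) / (fF y)\<^sup>2 +
       2 * \<epsilon> * (DX y v \<bullet> DX y v + X y \<bullet> snd (D2 y v v))))) (at 0)"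
        unfolding h'_def[abs_def]
        by (rule has_derivative_eq_rhs, rule has_derivative_add,
            rule has_derivative_divide'[OF has_derivative_fst[OF DF] fl],
            (use f_pos[OF y] in simp),
            rule has_derivative_mult_right[OF has_derivative_inner[OF X has_derivative_snd[OF DF]]])
          (use f_pos[OF y] in \<open>auto simp: inner_commute field_simps power2_eq_square\<close>)
      then show ?thesis by (simp add: has_field_derivative_def mult.commute[of "_::real" "_ + _"])
    qed
    show ?thesis
      using local_min_second_derivative[OF d 1 2] l(2) by (simp add: h'_def)
  qed
  have q: "slope y = ?q"
  proof (rule slope_eqI[OF y])
    fix v
    show "DT y v = fF y * (?q \<bullet> DX y v)"
    proof (cases "v = 0")
      case True
      then show ?thesis using linear_0[OF linear[OF y]] by simp
    next
      case False
      with both[OF False] f_pos[OF y] show ?thesis by (simp add: field_simps)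
    qed
  qed
  show ?thesis
  proof (rule mean_curvature_pos[OF y])
    fix v :: "real^'n" assume v: "v \<noteq> 0"
    let ?p = "slope y" and ?\<xi> = "DX y v"
    have \<xi>: "0 < ?\<xi> \<bullet> ?\<xi>" using DX_eq_0[OF y, of v] v by auto
    have f: "fF y > 0" by (rule f_pos[OF y])
    have Xp: "2 * \<epsilon> * (X y \<bullet> w) = - (?p \<bullet> w)" for w by (simp add: q)
    have pp: "?p \<bullet> ?p = 4 * \<epsilon>\<^sup>2 * (norm (X y))\<^sup>2"
      by (simp add: q power2_eq_square flip: power2_norm_eq_inner)
    have "0 < (1 - 4 * \<epsilon>\<^sup>2 * (norm (X y))\<^sup>2)" using slope_less_1[OF y] pp by simp
    with \<epsilon> \<epsilon>0 have f': "0 < fF' y" unfolding X_def by (smt (verit) mult_nonpos_nonneg)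
    have CS: "(?p \<bullet> ?\<xi>)\<^sup>2 \<le> (?p \<bullet> ?p) * (?\<xi> \<bullet> ?\<xi>)" by (rule Cauchy_Schwarz_ineq)
    have "fst (D2 y v v) / fF y - DT y v * (fF' y * DT y v) / (fF y)\<^sup>2 = fst (D2 y v v) / fF y - fF' y * (?p \<bullet> ?\<xi>)\<^sup>2"
      using f by (simp add: DT_eq[OF y] power2_eq_square)
    then have "fF' y * (?p \<bullet> ?\<xi>)\<^sup>2 - 2 * \<epsilon> * (?\<xi> \<bullet> ?\<xi>) \<le> fst (D2 y v v) / fF y - ?p \<bullet> snd (D2 y v v)"
      using both[OF v] by (simp add: distrib_left Xp)
    moreover have "2 * \<epsilon> * (?\<xi> \<bullet> ?\<xi>) < fF' y * (1 - ?p \<bullet> ?p) * (?\<xi> \<bullet> ?\<xi>)"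
      using \<epsilon> \<xi> unfolding pp X_def by (rule mult_strict_right_mono)
    moreover have "fF' y * (?p \<bullet> ?\<xi>)\<^sup>2 \<le> fF' y * ((?p \<bullet> ?p) * (?\<xi> \<bullet> ?\<xi>))"
      using CS f' by simp
    ultimately have "0 < fst (D2 y v v) / fF y - ?p \<bullet> snd (D2 y v v)
        + fF' y * (?\<xi> \<bullet> ?\<xi> - 2 * (?p \<bullet> ?\<xi>)\<^sup>2)"
      by (simp add: algebra_simps)
    then have "0 < fF y * (fst (D2 y v v) / fF y - ?p \<bullet> snd (D2 y v v)
        + fF' y * (?\<xi> \<bullet> ?\<xi> - 2 * (?p \<bullet> ?\<xi>)\<^sup>2))" using f by simp
    also have "\<dots> = fst (D2 y v v) - fF y * (slope y \<bullet> snd (D2 y v v)) +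
      fF y * fF' y * (?\<xi> \<bullet> ?\<xi> - 2 * (slope y \<bullet> ?\<xi>)\<^sup>2)"
      using f by (simp add: algebra_simps)
    finally show "0 < fst (D2 y v v) - fF y * (slope y \<bullet> snd (D2 y v v)) +
      fF y * fF' y * (?\<xi> \<bullet> ?\<xi> - 2 * (slope y \<bullet> ?\<xi>)\<^sup>2)" .
  qed
qed

end

section \<open>Local sections of the spatial projection\<close>

text \<open>Sections map Euclidean sets into a space known only through its open sets, hence the
  mixed form: distances in the source, neighbourhoods in the target.\<close>

lemma continuous_map_metric_iff:
  fixes D :: "'b::metric_space set"
  shows "continuous_map (top_of_set D) M \<sigma> \<longleftrightarrow>
    \<sigma> \<in> D \<rightarrow> topspace M \<and>
    (\<forall>z\<in>D. \<forall>W. openin M W \<and> \<sigma> z \<in> W \<longrightarrow> (\<exists>\<delta>>0. \<forall>z'\<in>D. dist z' z < \<delta> \<longrightarrow> \<sigma> z' \<in> W))"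
proof -
  have "openin (top_of_set D) {z \<in> D. \<sigma> z \<in> W} \<longleftrightarrow>
      (\<forall>z\<in>D. \<sigma> z \<in> W \<longrightarrow> (\<exists>\<delta>>0. \<forall>z'\<in>D. dist z' z < \<delta> \<longrightarrow> \<sigma> z' \<in> W))" for W
    unfolding openin_euclidean_subtopology_iff by auto
  then show ?thesis unfolding continuous_map_def by auto
qed

lemma continuous_map_metricD:
  fixes D :: "'b::metric_space set"
  assumes "continuous_map (top_of_set D) M \<sigma>" "z \<in> D" "openin M W" "\<sigma> z \<in> W"
  obtains \<delta> where "\<delta> > 0" "\<And>z'. z' \<in> D \<Longrightarrow> dist z' z < \<delta> \<Longrightarrow> \<sigma> z' \<in> W"
  using assms unfolding continuous_map_metric_iff by meson

text \<open>The geometry is developed for a general warped product; the warping function of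
  Einstein-de Sitter is inserted only at the end.\<close>

locale grw_hypersurface =
  fixes f f' :: "real \<Rightarrow> real" and I :: "real set" and M :: "'a topology"
    and A :: "('a, 'n::finite) chart set" and \<psi> :: "'a \<Rightarrow> 'n spacetime"
  assumes hyp: "spacelike_hypersurface (grw_domain I) (grw_metric f) M A \<psi>"
    and pos: "\<And>t. t \<in> I \<Longrightarrow> 0 < f t"
    and deriv: "\<And>t. t \<in> I \<Longrightarrow> (f has_real_derivative f' t) (at t)"
begin

abbreviation X where "X q \<equiv> snd (\<psi> q)"
abbreviation \<tau> where "\<tau> q \<equiv> fst (\<psi> q)"
abbreviation F where "F c \<equiv> \<psi> \<circ> chart_inv c"
abbreviation DX where "DX c y v \<equiv> snd (diff_at (F c) y v)"

section \<open>Charts and continuity of the immersion\<close>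

lemma Hausdorff: "Hausdorff_space M"
  and immersion: "immersion A \<psi>"
  and charts: "\<And>c. c \<in> A \<Longrightarrow> is_chart M c"
  and charts_cover: "(\<Union>c\<in>A. chart_dom c) = topspace M"
  using hyp by (auto simp: spacelike_hypersurface_def smooth_manifold_def smooth_atlas_def)

lemma \<tau>_in: "q \<in> topspace M \<Longrightarrow> \<tau> q \<in> I"
  using hyp by (auto simp: spacelike_hypersurface_def grw_domain_def)

lemma obtain_chart:
  assumes "q \<in> topspace M" obtains c where "c \<in> A" "q \<in> chart_dom c"
  using assms charts_cover by blast

lemma open_dom: "c \<in> A \<Longrightarrow> openin M (chart_dom c)"
  and open_im: "c \<in> A \<Longrightarrow> open (chart_im c)"
  and homeo: "c \<in> A \<Longrightarrow>
    homeomorphic_map (subtopology M (chart_dom c)) (top_of_set (chart_im c)) (chart_map c)"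
  using charts by (auto simp: is_chart_def)

lemma dom_subset: "c \<in> A \<Longrightarrow> chart_dom c \<subseteq> topspace M"
  using open_dom openin_subset by blast

lemma topspace_dom: "c \<in> A \<Longrightarrow> topspace (subtopology M (chart_dom c)) = chart_dom c"
  using dom_subset[of c] by auto

lemma inj_chart: "c \<in> A \<Longrightarrow> inj_on (chart_map c) (chart_dom c)"
  using homeomorphic_imp_injective_map[OF homeo] topspace_dom by metis

lemma chart_inv_map: "c \<in> A \<Longrightarrow> q \<in> chart_dom c \<Longrightarrow> chart_inv c (chart_map c q) = q"
  using inj_chart by (simp add: inv_into_f_f)

lemma chart_map_inv: "y \<in> chart_im c \<Longrightarrow> chart_map c (chart_inv c y) = y"
  by (rule f_inv_into_f)

lemma chart_inv_in: "y \<in> chart_im c \<Longrightarrow> chart_inv c y \<in> chart_dom c"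
  by (rule inv_into_into)

lemma continuous_chart_map:
  "c \<in> A \<Longrightarrow> continuous_map (subtopology M (chart_dom c)) euclidean (chart_map c)"
  using homeomorphic_imp_continuous_map[OF homeo] continuous_map_into_fulltopology by blast

lemma openin_chart_preimage:
  assumes c: "c \<in> A" and W: "open W"
  shows "openin M {q \<in> chart_dom c. chart_map c q \<in> W}"
proof -
  have "openin (subtopology M (chart_dom c)) {q \<in> topspace (subtopology M (chart_dom c)). chart_map c q \<in> W}"
    using openin_continuous_map_preimage[OF continuous_chart_map[OF c], of W] W by simp
  then show ?thesis
    unfolding topspace_dom[OF c] openin_open_subtopology[OF open_dom[OF c]] by simp
qed

lemma chart_inv_image:
  assumes c: "c \<in> A" and W: "W \<subseteq> chart_im c"
  shows "chart_inv c ` W = {q \<in> chart_dom c. chart_map c q \<in> W}"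
proof
  show "chart_inv c ` W \<subseteq> {q \<in> chart_dom c. chart_map c q \<in> W}"
  proof
    fix q assume "q \<in> chart_inv c ` W"
    then obtain y where "y \<in> W" "q = chart_inv c y" by blast
    then show "q \<in> {q \<in> chart_dom c. chart_map c q \<in> W}"
      using W chart_inv_in[of y c] chart_map_inv[of y c] by auto
  qed
  show "{q \<in> chart_dom c. chart_map c q \<in> W} \<subseteq> chart_inv c ` W"
  proof
    fix q assume "q \<in> {q \<in> chart_dom c. chart_map c q \<in> W}"
    then have "q = chart_inv c (chart_map c q)" "chart_map c q \<in> W"
      using chart_inv_map[OF c, of q] by auto
    then show "q \<in> chart_inv c ` W" by (rule image_eqI)
  qed
qed

lemma openin_chart_image:
  assumes c: "c \<in> A" and W: "open W" "W \<subseteq> chart_im c"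
  shows "openin M (chart_inv c ` W)"
  unfolding chart_inv_image[OF c W(2)] by (rule openin_chart_preimage[OF c W(1)])

lemma open_chart_image:
  assumes c: "c \<in> A" and W: "openin M W" "W \<subseteq> chart_dom c"
  shows "open (chart_map c ` W)"
proof -
  have "openin (top_of_set (chart_im c)) (chart_map c ` W)"
    using homeomorphic_imp_open_map[OF homeo[OF c]] W
    by (simp add: open_map_def openin_open_subtopology[OF open_dom[OF c]])
  then show ?thesis using open_im[OF c] openin_open_trans by blast
qed

lemma continuous_chart_inv:
  assumes c: "c \<in> A" shows "continuous_map (top_of_set (chart_im c)) M (chart_inv c)"
  unfolding continuous_map_metric_iff
proof (intro conjI ballI allI impI)
  show "chart_inv c \<in> chart_im c \<rightarrow> topspace M"
    by (intro Pi_I subsetD[OF dom_subset[OF c]] chart_inv_in)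
  fix z W assume z: "z \<in> chart_im c" and W: "openin M W \<and> chart_inv c z \<in> W"
  have "open (chart_map c ` (W \<inter> chart_dom c))"
    using W open_dom[OF c] by (intro open_chart_image[OF c]) auto
  moreover have "z \<in> chart_map c ` (W \<inter> chart_dom c)"
    using W chart_inv_in[OF z] chart_map_inv[OF z] by force
  ultimately obtain \<delta> where "\<delta> > 0" "\<And>z'. dist z' z < \<delta> \<Longrightarrow> z' \<in> chart_map c ` (W \<inter> chart_dom c)"
    by (meson open_dist)
  moreover have "chart_inv c z' \<in> W" if "z' \<in> chart_map c ` (W \<inter> chart_dom c)" for z'
    using that chart_inv_map[OF c] by (elim imageE) simp
  ultimately show "\<exists>\<delta>>0. \<forall>z'\<in>chart_im c. dist z' z < \<delta> \<longrightarrow> chart_inv c z' \<in> W"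
    by meson
qed

lemma param:
  assumes c: "c \<in> A" shows "grw_param f f' (chart_im c) (F c)"
proof
  show "open (chart_im c)" by (rule open_im[OF c])
  show "Ck_on 2 (F c) (chart_im c)" using immersion c by (simp add: immersion_def smooth_on_def)
  fix y assume y: "y \<in> chart_im c"
  have in_I: "fst (F c y) \<in> I" using \<tau>_in chart_inv_in[OF y] dom_subset[OF c] by auto
  show "0 < f (fst (F c y))" by (rule pos[OF in_I])
  show "(f has_real_derivative f' (fst (F c y))) (at (fst (F c y)))" by (rule deriv[OF in_I])
  fix v :: "real^'n" assume v: "v \<noteq> 0"
  have "0 < induced_metric (grw_metric f) \<psi> c (chart_inv c y) v v"
    using hyp c chart_inv_in[OF y] v by (simp add: spacelike_hypersurface_def)
  then show "0 < grw_metric f (F c y) (diff_at (F c) y v) (diff_at (F c) y v)"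
    by (simp add: induced_metric_def chart_map_inv[OF y])
qed

lemma continuous_on_F: "c \<in> A \<Longrightarrow> continuous_on (chart_im c) (F c)"
  using grw_param.has_derivative[OF param] has_derivative_continuous continuous_at_imp_continuous_on
  by (metis)

lemma continuous_\<psi>: "continuous_map M euclidean \<psi>"
proof (rule pasting_lemma[where I = A and T = chart_dom and f = "\<lambda>_. \<psi>"])
  fix c assume c: "c \<in> A"
  show "openin M (chart_dom c)" by (rule open_dom[OF c])
  have "continuous_map (subtopology M (chart_dom c)) euclidean (F c \<circ> chart_map c)"
    using continuous_map_compose[OF homeomorphic_imp_continuous_map[OF homeo[OF c]]]
      continuous_on_F[OF c] by (metis continuous_map_iff_continuous)
  then show "continuous_map (subtopology M (chart_dom c)) euclidean \<psi>"
    by (rule continuous_map_eq) (use chart_inv_map[OF c] in auto)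
next
  fix q assume "q \<in> topspace M"
  then show "\<exists>c. c \<in> A \<and> q \<in> chart_dom c \<and> \<psi> q = \<psi> q" by (meson obtain_chart)
qed simp

lemma continuous_X: "continuous_map M euclidean X"
  using continuous_map_compose[OF continuous_\<psi>, of euclidean snd]
  by (simp add: o_def continuous_on_snd)

section \<open>Sections of the spatial projection and their uniqueness\<close>

lemma openin_X_preimage:
  assumes "openin M V" "open W" shows "openin M {q \<in> V. X q \<in> W}"
  using openin_continuous_map_preimage_gen[OF continuous_X assms(1), of W] assms(2) by simp

text \<open>Openness of the image is part of the notion so that it serves as a neighbourhood in M.
  On it X is a homeomorphism onto the ball, with inverse \<open>\<sigma>\<close>.\<close>

definition sheet :: "real^'n \<Rightarrow> real \<Rightarrow> (real^'n \<Rightarrow> 'a) \<Rightarrow> bool" where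
  "sheet a r \<sigma> \<longleftrightarrow> 0 < r \<and> continuous_map (top_of_set (ball a r)) M \<sigma> \<and>
     (\<forall>z\<in>ball a r. X (\<sigma> z) = z) \<and> openin M (\<sigma> ` ball a r)"

lemma sheet_shrink:
  assumes s: "sheet a r \<sigma>" and r': "0 < r'" "r' \<le> r"
  shows "sheet a r' \<sigma>"
proof -
  have sub: "ball a r' \<subseteq> ball a r" using r' by auto
  have "\<sigma> ` ball a r' = {q \<in> \<sigma> ` ball a r. X q \<in> ball a r'}"
    using s sub by (force simp: sheet_def)
  then have "openin M (\<sigma> ` ball a r')"
    using openin_X_preimage[of "\<sigma> ` ball a r" "ball a r'"] s by (simp add: sheet_def)
  then show ?thesis
    using s sub r'(1) continuous_map_from_subtopology_mono by (fastforce simp: sheet_def)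
qed

text \<open>The inverse function theorem is applied to the spatial part of the immersion in a chart;
  its derivative is invertible by spacelikeness. The section is the local inverse followed by the
  inverse chart.\<close>

lemma ex_sheet:
  assumes q: "q \<in> topspace M" shows "\<exists>r \<sigma>. sheet (X q) r \<sigma> \<and> \<sigma> (X q) = q"
proof -
  obtain c where c: "c \<in> A" "q \<in> chart_dom c" using obtain_chart[OF q] .
  interpret P: grw_param f f' "chart_im c" "F c" by (rule param[OF c(1)])
  define y where "y = chart_map c q"
  have y: "y \<in> chart_im c" "chart_inv c y = q" using c chart_inv_map by (auto simp: y_def)
  define G where "G y = snd (F c y)" for y
  define L where "L y = Blinfun (DX c y)" for y
  have bl: "bounded_linear (DX c z)" if "z \<in> chart_im c" for z
    using P.linear_DX[OF that] linear_conv_bounded_linear by blast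
  have L: "blinfun_apply (L z) = DX c z" if "z \<in> chart_im c" for z
    unfolding L_def using bl[OF that] by (rule bounded_linear_Blinfun_apply)
  have der: "(G has_derivative blinfun_apply (L z)) (at z)" if "z \<in> chart_im c" for z
    unfolding G_def L[OF that] by (rule has_derivative_snd[OF P.has_derivative[OF that]])
  have cont: "continuous_on (chart_im c) L"
  proof (rule continuous_on_blinfun_componentwise)
    fix i :: "real^'n"
    have "continuous_on (chart_im c) (\<lambda>z. DX c z i)"
      using has_derivative_continuous[OF has_derivative_snd[OF P.has_derivative2]]
        continuous_at_imp_continuous_on by blast
    then show "continuous_on (chart_im c) (\<lambda>z. blinfun_apply (L z) i)"
      by (rule continuous_on_eq) (simp add: L)
  qed
  have inv: "Blinfun (inv (DX c y)) o\<^sub>L L y = id_blinfun"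
  proof (rule blinfun_eqI)
    fix v
    have "linear (inv (DX c y))"
      by (rule inj_linear_imp_inv_linear[OF P.linear_DX P.inj_DX]) fact+
    then have "bounded_linear (inv (DX c y))" using linear_conv_bounded_linear by blast
    then show "blinfun_apply (Blinfun (inv (DX c y)) o\<^sub>L L y) v = blinfun_apply id_blinfun v"
      using inv_f_f[OF P.inj_DX[OF y(1)]] by (simp add: bounded_linear_Blinfun_apply L[OF y(1)])
  qed
  obtain U V g where U: "open U" "U \<subseteq> chart_im c" "y \<in> U" and V: "open V" "G y \<in> V"
    and hom: "homeomorphism U V G g"
    using inverse_function_theorem[OF P.open_S der cont y(1) inv] by metis
  have Gy: "G y = X q" by (simp add: G_def y)
  obtain r where r: "r > 0" "ball (X q) r \<subseteq> V" using V Gy openE by metis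
  define \<sigma> where "\<sigma> = chart_inv c \<circ> g"
  have gU: "g z \<in> U" "G (g z) = z" if "z \<in> V" for z
    using hom that unfolding homeomorphism_def by blast+
  have gG: "g (G z) = z" if "z \<in> U" for z using hom that unfolding homeomorphism_def by blast
  have "continuous_on (ball (X q) r) g"
    using hom r(2) homeomorphism_cont2 continuous_on_subset by blast
  then have "continuous_map (top_of_set (ball (X q) r)) (top_of_set (chart_im c)) g"
    using gU(1) U(2) r(2) by (simp add: continuous_map_in_subtopology Pi_iff) blast
  then have 1: "continuous_map (top_of_set (ball (X q) r)) M \<sigma>"
    unfolding \<sigma>_def by (rule continuous_map_compose[OF _ continuous_chart_inv[OF c(1)]])
  have 2: "X (\<sigma> z) = z" if "z \<in> ball (X q) r" for z
    using gU(2)[of z] that r(2) by (auto simp: \<sigma>_def G_def)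
  \<comment> \<open>The image of the ball under the local inverse is a preimage under the continuous
    map \<open>G\<close>, and therefore open.\<close>
  have "g ` ball (X q) r = U \<inter> G -` ball (X q) r"
    using gU gG r(2) by (auto simp: image_iff) (metis subsetD mem_ball)+
  moreover have "continuous_on U G" using hom by (simp add: homeomorphism_def)
  ultimately have "open (g ` ball (X q) r)"
    by (metis continuous_open_preimage U(1) open_ball)
  then have 3: "openin M (\<sigma> ` ball (X q) r)"
    unfolding \<sigma>_def image_comp[symmetric]
    by (rule openin_chart_image[OF c(1)]) (use gU(1) r(2) U(2) in blast)
  have "\<sigma> (X q) = q" using gG[OF U(3)] y by (simp add: \<sigma>_def Gy)
  with 1 2 3 r(1) show ?thesis unfolding sheet_def by blast
qed

lemma sheet_X:
  assumes "sheet a r \<sigma>" "q \<in> \<sigma> ` ball a r"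
  shows "X q \<in> ball a r" "\<sigma> (X q) = q"
  using assms by (auto simp: sheet_def)

lemma sheet_eq:
  assumes s: "sheet a r \<sigma>" and q: "q \<in> \<sigma> ` ball a r" "q' \<in> \<sigma> ` ball a r" "X q = X q'"
  shows "q = q'"
  using sheet_X[OF s] q by metis

definition lift_on :: "(real^'n) set \<Rightarrow> (real^'n \<Rightarrow> 'a) \<Rightarrow> bool" where
  "lift_on D s \<longleftrightarrow> continuous_map (top_of_set D) M s \<and> (\<forall>z\<in>D. X (s z) = z)"

lemma lift_onD: "lift_on D s \<Longrightarrow> z \<in> D \<Longrightarrow> s z \<in> topspace M" "lift_on D s \<Longrightarrow> z \<in> D \<Longrightarrow> X (s z) = z"
  by (auto simp: lift_on_def continuous_map_def)

lemma lift_on_subset: "lift_on D s \<Longrightarrow> D' \<subseteq> D \<Longrightarrow> lift_on D' s"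
  unfolding lift_on_def using continuous_map_from_subtopology_mono by blast

lemma sheet_lift: "sheet a r \<sigma> \<Longrightarrow> lift_on (ball a r) \<sigma>"
  by (simp add: sheet_def lift_on_def)

text \<open>The coincidence set is closed because M is Hausdorff, and open because near a common
  value both lifts run in one sheet, on which X is injective.\<close>

lemma lift_unique:
  assumes s: "lift_on D s" "lift_on D s'" and D: "connected D"
    and z0: "z0 \<in> D" "s z0 = s' z0" and z: "z \<in> D"
  shows "s z = s' z"
proof -
  let ?E = "{z \<in> topspace (top_of_set D). s z = s' z}"
  have "closedin (top_of_set D) ?E"
    using closedin_continuous_maps_eq[OF Hausdorff] s unfolding lift_on_def by blast
  moreover have "openin (top_of_set D) ?E"
    unfolding openin_euclidean_subtopology_iff
  proof (intro conjI ballI)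
    fix w assume "w \<in> ?E"
    then have w: "w \<in> D" "s w = s' w" by auto
    obtain r \<sigma> where \<sigma>: "sheet w r \<sigma>" "\<sigma> w = s w"
      using ex_sheet[OF lift_onD(1)[OF s(1) w(1)]] lift_onD(2)[OF s(1) w(1)] by auto
    have op: "openin M (\<sigma> ` ball w r)" and r: "r > 0" using \<sigma> by (auto simp: sheet_def)
    have "s w \<in> \<sigma> ` ball w r" using \<sigma>(2) r by (metis centre_in_ball imageI)
    obtain d1 where d1: "d1 > 0" "\<And>z'. z' \<in> D \<Longrightarrow> dist z' w < d1 \<Longrightarrow> s z' \<in> \<sigma> ` ball w r"
      using continuous_map_metricD[of D M s w] s(1) w(1) op \<open>s w \<in> \<sigma> ` ball w r\<close>
      unfolding lift_on_def by metis
    obtain d2 where d2: "d2 > 0" "\<And>z'. z' \<in> D \<Longrightarrow> dist z' w < d2 \<Longrightarrow> s' z' \<in> \<sigma> ` ball w r"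
      using continuous_map_metricD[of D M s' w] s(2) w op \<open>s w \<in> \<sigma> ` ball w r\<close>
      unfolding lift_on_def by metis
    have "s z' = s' z'" if "z' \<in> D" "dist z' w < min d1 d2" for z'
      using sheet_eq[OF \<sigma>(1) d1(2) d2(2)] that lift_onD(2)[OF s(1)] lift_onD(2)[OF s(2)] by auto
    then show "\<exists>e>0. \<forall>z'\<in>D. dist z' w < e \<longrightarrow> z' \<in> ?E"
      using d1(1) d2(1) by (intro exI[of _ "min d1 d2"]) auto
  qed auto
  ultimately have "?E = {} \<or> ?E = D" using D unfolding connected_clopen by blast
  then show ?thesis using z0 z by auto
qed

text \<open>A lift is assumed only continuous. In a chart it inverts the spatial part of the
  immersion, whose derivative is invertible, and a continuous inverse of such a map is
  differentiable.\<close>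

lemma lift_derivative:
  assumes s: "lift_on D s" and D: "open D" "z \<in> D" and c: "c \<in> A" "s z \<in> chart_dom c"
  shows "((\<lambda>z. chart_map c (s z)) has_derivative inv (DX c (chart_map c (s z)))) (at z)"
proof -
  interpret P: grw_param f f' "chart_im c" "F c" by (rule param[OF c(1)])
  define y where "y = chart_map c (s z)"
  have y: "y \<in> chart_im c" using c by (simp add: y_def)
  have near: "\<exists>d>0. \<forall>z'. dist z' w < d \<longrightarrow> z' \<in> D \<and> s z' \<in> W"
    if W: "openin M W" "s w \<in> W" "w \<in> D" for W w
  proof -
    obtain d where "d > 0" "\<And>z'. z' \<in> D \<Longrightarrow> dist z' w < d \<Longrightarrow> s z' \<in> W"
      using continuous_map_metricD[of D M s w W] s W unfolding lift_on_def by metis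
    moreover obtain e where "e > 0" "\<And>z'. dist z' w < e \<Longrightarrow> z' \<in> D"
      using D(1) W(3) by (meson open_dist)
    ultimately show ?thesis by (intro exI[of _ "min d e"]) auto
  qed
  define T where "T = {w \<in> D. s w \<in> chart_dom c}"
  have "open T"
    unfolding open_dist T_def using near[OF open_dom[OF c(1)]] by blast
  have lin: "linear (inv (DX c y))"
    by (rule inj_linear_imp_inv_linear[OF P.linear_DX[OF y] P.inj_DX[OF y]])
  show ?thesis
    unfolding y_def[symmetric]
  proof (rule has_derivative_inverse_basic[where f = "\<lambda>y. snd (F c y)" and f' = "DX c y" and T = T])
    show "((\<lambda>y. snd (F c y)) has_derivative DX c y) (at (chart_map c (s z)))"
      using has_derivative_snd[OF P.has_derivative[OF y]] by (simp add: y_def)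
    show "bounded_linear (inv (DX c y))" using lin linear_conv_bounded_linear by blast
    show "inv (DX c y) \<circ> DX c y = id" using P.inj_DX[OF y] by (rule inv_o_cancel)
    show "open T" by fact
    show "z \<in> T" using D c by (simp add: T_def)
    show "snd (F c (chart_map c (s w))) = w" if "w \<in> T" for w
      using that chart_inv_map[OF c(1)] lift_onD(2)[OF s] by (simp add: T_def)
    show "continuous (at z) (\<lambda>z. chart_map c (s z))"
      unfolding continuous_at_eps_delta
    proof (intro allI impI)
      fix e :: real assume "e > 0"
      let ?W = "{q \<in> chart_dom c. chart_map c q \<in> ball y e}"
      have "openin M ?W" by (rule openin_chart_preimage[OF c(1)]) simp
      moreover have "s z \<in> ?W" using c(2) \<open>e > 0\<close> by (simp add: y_def)
      ultimately obtain d where "d > 0" "\<forall>z'. dist z' z < d \<longrightarrow> z' \<in> D \<and> s z' \<in> ?W"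
        using near[of ?W z] D(2) by blast
      then show "\<exists>d>0. \<forall>x'. dist x' z < d \<longrightarrow> dist (chart_map c (s x')) (chart_map c (s z)) < e"
        by (auto simp: y_def dist_commute)
    qed
  qed
qed

end

section \<open>Length and distance\<close>

text \<open>Piecewise regularity speaks only about intervals whose interior avoids the break points.
  Induction on the number of break points inside cuts the interval at one of them.\<close>

lemma integrable_on_split_finite:
  fixes h :: "real \<Rightarrow> real"
  assumes S: "finite S" and ab: "a \<le> b"
    and h: "\<And>c d. a \<le> c \<Longrightarrow> c < d \<Longrightarrow> d \<le> b \<Longrightarrow> {c<..<d} \<inter> S = {} \<Longrightarrow> h integrable_on {c..d}"
  shows "h integrable_on {a..b}"
  using ab h
proof (induction "card (S \<inter> {a<..<b})" arbitrary: a b rule: less_induct)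
  case less
  show ?case
  proof (cases "a = b \<or> {a<..<b} \<inter> S = {}")
    case True
    show ?thesis
    proof (cases "a = b")
      case True
      then show ?thesis using integrable_on_refl[of h a] by simp
    next
      case False
      with \<open>a = b \<or> _\<close> show ?thesis using less.prems by simp
    qed
  next
    case False
    then obtain s where s: "s \<in> S" "a < s" "s < b" by auto
    have "card (S \<inter> {a<..<s}) < card (S \<inter> {a<..<b})" "card (S \<inter> {s<..<b}) < card (S \<inter> {a<..<b})"
      using s S by (auto intro!: psubset_card_mono)
    then have "h integrable_on {a..s}" "h integrable_on {s..b}"
      using less.hyps[of a s] less.hyps[of s b] s less.prems by auto
    then show ?thesis using s by (intro Henstock_Kurzweil_Integration.integrable_combine[of a s b]) auto
  qed
qed

lemma finite_avoiding_interval: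
  fixes t :: real
  assumes "finite S" "t \<notin> S" "0 < t" "t < 1"
  obtains a b where "0 \<le> a" "a < t" "t < b" "b \<le> 1" "{a<..<b} \<inter> S = {}"
proof -
  obtain d where d: "d > 0" "\<And>s. s \<in> S \<Longrightarrow> s \<noteq> t \<Longrightarrow> d \<le> dist t s"
    using finite_set_avoid[OF assms(1)] by metis
  define e where "e = Min {d, t, 1 - t}"
  have e: "0 < e" "e \<le> d" "e \<le> t" "e \<le> 1 - t" using d assms by (auto simp: e_def)
  show ?thesis
  proof (rule that[of "t - e" "t + e"])
    show "{t - e<..<t + e} \<inter> S = {}"
    proof (rule ccontr)
      assume "{t - e<..<t + e} \<inter> S \<noteq> {}"
      then obtain s where s: "s \<in> S" "t - e < s" "s < t + e" by auto
      then have "d \<le> dist t s" using d(2) assms(2) by blast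
      then show False using s e by (simp add: dist_real_def)
    qed
  qed (use e in auto)
qed

context grw_hypersurface
begin

section \<open>Curves, their lengths, and comparison with Euclidean distance\<close>

abbreviation G where "G \<equiv> induced_metric (grw_metric f) \<psi>"

definition speed :: "(real \<Rightarrow> 'a) \<Rightarrow> real \<Rightarrow> real" where
  "speed \<gamma> t = (let c = chart_at A (\<gamma> t); v = vector_derivative (chart_map c \<circ> \<gamma>) (at t)
            in sqrt (G c (\<gamma> t) v v))"

lemma curve_length_speed: "curve_length A G \<gamma> = integral {0..1} (speed \<gamma>)"
  by (simp add: curve_length_def speed_def[abs_def])

lemma chart_at:
  assumes "q \<in> topspace M" shows "chart_at A q \<in> A" "q \<in> chart_dom (chart_at A q)"
proof -
  obtain c where "c \<in> A \<and> q \<in> chart_dom c" using obtain_chart[OF assms] by blast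
  from someI[of "\<lambda>c. c \<in> A \<and> q \<in> chart_dom c", OF this]
  show "chart_at A q \<in> A" "q \<in> chart_dom (chart_at A q)" by (auto simp: chart_at_def)
qed

lemma induced_metric_nonneg:
  assumes c: "c \<in> A" "q \<in> chart_dom c" shows "0 \<le> G c q v v"
proof (cases "v = 0")
  case True
  interpret P: grw_param f f' "chart_im c" "F c" by (rule param[OF c(1)])
  have "chart_map c q \<in> chart_im c" using c by simp
  then show ?thesis
    using True linear_0[OF P.linear] by (simp add: induced_metric_def grw_metric_def)
next
  case False
  then show ?thesis using hyp c unfolding spacelike_hypersurface_def by (meson less_imp_le)
qed

lemma speed_nonneg: "\<gamma> t \<in> topspace M \<Longrightarrow> 0 \<le> speed \<gamma> t"
  using induced_metric_nonneg chart_at by (simp add: speed_def Let_def)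

text \<open>The length integrand uses \<open>chart_at\<close>, which may jump from point to point,
  so its regularity is not visible in coordinates. The image curve in the ambient vector space has a
  velocity independent of the chart, from which the speed will be read off.\<close>

lemma image_curve_derivative:
  assumes \<gamma>: "continuous_map (top_of_set {0..1}) M \<gamma>" and ab: "0 \<le> a" "a < b" "b \<le> 1"
    and C1: "C1_curve_on A a b \<gamma>" and t: "t \<in> {a..b}" and c: "c \<in> A" "\<gamma> t \<in> chart_dom c"
  shows "((\<lambda>t. \<psi> (\<gamma> t)) has_vector_derivative
    diff_at (F c) (chart_map c (\<gamma> t)) (vector_derivative (chart_map c \<circ> \<gamma>) (at t within {a..b})))
    (at t within {a..b})"
proof -
  interpret P: grw_param f f' "chart_im c" "F c" by (rule param[OF c(1)])
  have "(chart_map c \<circ> \<gamma>) differentiable (at t within {a..b})"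
    using C1 t c unfolding C1_curve_on_def Let_def by blast
  then have 1: "((chart_map c \<circ> \<gamma>) has_vector_derivative
      vector_derivative (chart_map c \<circ> \<gamma>) (at t within {a..b})) (at t within {a..b})"
    using vector_derivative_works by blast
  have "chart_map c (\<gamma> t) \<in> chart_im c" using c by simp
  then have 2: "(F c has_derivative diff_at (F c) (chart_map c (\<gamma> t))) (at ((chart_map c \<circ> \<gamma>) t))"
    using P.has_derivative by simp
  have 3: "((F c \<circ> (chart_map c \<circ> \<gamma>)) has_vector_derivative
    diff_at (F c) (chart_map c (\<gamma> t)) (vector_derivative (chart_map c \<circ> \<gamma>) (at t within {a..b})))
    (at t within {a..b})"
    by (rule vector_derivative_diff_chain_within[OF 1 has_derivative_at_withinI[OF 2]])
  obtain \<delta> where \<delta>: "\<delta> > 0" "\<And>z'. z' \<in> {0..1} \<Longrightarrow> dist z' t < \<delta> \<Longrightarrow> \<gamma> z' \<in> chart_dom c"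
    using continuous_map_metricD[OF \<gamma> _ open_dom[OF c(1)] c(2)] t ab by auto
  show ?thesis
    by (rule has_vector_derivative_transform_within[OF 3 \<delta>(1) t])
      (use \<delta>(2) chart_inv_map[OF c(1)] ab in auto)
qed

lemma continuous_image_curve:
  assumes "continuous_map (top_of_set {0..1}) M \<gamma>"
  shows "continuous_on {0..1} (\<lambda>t. \<psi> (\<gamma> t))"
  using continuous_map_compose[OF assms continuous_\<psi>] by (simp add: o_def)

text \<open>The smoothness hypothesis gives continuity of \<open>diff_at (F c) y w\<close> in
  \<open>y\<close> for each fixed \<open>w\<close>. Expanding the coordinate velocity in the
  standard basis reduces the moving argument to finitely many fixed ones.\<close>

lemma continuous_image_curve_derivative:
  assumes \<gamma>: "continuous_map (top_of_set {0..1}) M \<gamma>" and ab: "0 \<le> a" "a < b" "b \<le> 1"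
    and C1: "C1_curve_on A a b \<gamma>"
  shows "continuous_on {a..b} (\<lambda>t. vector_derivative (\<lambda>t. \<psi> (\<gamma> t)) (at t within {a..b}))"
  unfolding continuous_on_eq_continuous_within
proof
  fix t assume t: "t \<in> {a..b}"
  let ?B = "\<lambda>t. vector_derivative (\<lambda>t. \<psi> (\<gamma> t)) (at t within {a..b})"
  have "\<gamma> t \<in> topspace M" using \<gamma> t ab by (auto simp: continuous_map_def)
  then obtain c where c: "c \<in> A" "\<gamma> t \<in> chart_dom c" by (rule obtain_chart)
  interpret P: grw_param f f' "chart_im c" "F c" by (rule param[OF c(1)])
  define J where "J = {t \<in> {a..b}. \<gamma> t \<in> chart_dom c}"
  let ?v = "\<lambda>t. vector_derivative (chart_map c \<circ> \<gamma>) (at t within {a..b})"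
  have v: "continuous_on J ?v"
    using C1 c(1) unfolding C1_curve_on_def Let_def J_def by blast
  have J: "chart_map c (\<gamma> s) \<in> chart_im c" if "s \<in> J" for s using that by (simp add: J_def)
  have cm: "continuous_on J (\<lambda>t. chart_map c (\<gamma> t))"
  proof -
    have "(chart_map c \<circ> \<gamma>) differentiable (at t within {a..b})" if "t \<in> J" for t
      using C1 c(1) that unfolding C1_curve_on_def Let_def J_def by blast
    then have "continuous (at t within J) (chart_map c \<circ> \<gamma>)" if "t \<in> J" for t
      using that differentiable_imp_continuous_within continuous_within_subset
      by (metis (no_types, lifting) J_def mem_Collect_eq subsetI)
    then show ?thesis by (simp add: continuous_on_eq_continuous_within o_def)
  qed
  have "continuous_on (chart_im c) (\<lambda>y. diff_at (F c) y w)" for w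
    using has_derivative_continuous[OF P.has_derivative2] continuous_at_imp_continuous_on by blast
  then have D: "continuous_on J (\<lambda>t. diff_at (F c) (chart_map c (\<gamma> t)) w)" for w
    using continuous_on_compose2[OF _ cm] J by blast
  have "continuous_on J (\<lambda>t. \<Sum>i\<in>UNIV. ?v t $ i *\<^sub>R diff_at (F c) (chart_map c (\<gamma> t)) (axis i 1))"
    by (intro continuous_intros v D)
  moreover have "?B s = (\<Sum>i\<in>UNIV. ?v s $ i *\<^sub>R diff_at (F c) (chart_map c (\<gamma> s)) (axis i 1))"
    if s: "s \<in> J" for s
  proof -
    have "?B s = diff_at (F c) (chart_map c (\<gamma> s)) (?v s)"
      using s c(1) ab by (intro vector_derivative_within_closed_interval
          image_curve_derivative[OF \<gamma> ab C1]) (auto simp: J_def)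
    also have "?v s = (\<Sum>i\<in>UNIV. ?v s $ i *\<^sub>R axis i 1)"
      using basis_expansion[of "?v s"] by (simp add: scalar_mult_eq_scaleR)
    finally show ?thesis
      by (simp only: linear_sum[OF P.linear[OF J[OF s]]] linear_cmul[OF P.linear[OF J[OF s]]])
  qed
  ultimately have "continuous_on J ?B" by (simp cong: continuous_on_cong)
  then have cJ: "continuous (at t within J) ?B"
    using t c by (simp add: J_def continuous_on_eq_continuous_within)
  obtain \<delta> where \<delta>: "\<delta> > 0" "\<And>z'. z' \<in> {0..1} \<Longrightarrow> dist z' t < \<delta> \<Longrightarrow> \<gamma> z' \<in> chart_dom c"
    using continuous_map_metricD[OF \<gamma> _ open_dom[OF c(1)] c(2)] t ab by auto
  \<comment> \<open>The set of times spent in the chart contains all times of the interval near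
    \<open>t\<close>, so restricting to it does not change the limit.\<close>
  have "at t within J = at t within {a..b}"
    by (rule at_within_nhd[of t "ball t \<delta>"]) (use \<delta> ab in \<open>auto simp: J_def dist_commute\<close>)
  then show "continuous (at t within {a..b}) ?B" using cJ by simp
qed

lemma curve_point:
  assumes \<gamma>: "piecewise_C1_curve M A \<gamma>"
  shows "continuous_map (top_of_set {0..1}) M \<gamma>" "t \<in> {0..1} \<Longrightarrow> \<gamma> t \<in> topspace M"
  using \<gamma> by (auto simp: piecewise_C1_curve_def pathin_def continuous_map_def)

lemma image_curve_derivative_at:
  assumes \<gamma>: "continuous_map (top_of_set {0..1}) M \<gamma>" and ab: "0 \<le> a" "a < b" "b \<le> 1"
    and C1: "C1_curve_on A a b \<gamma>" and t: "a < t" "t < b"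
  shows "c \<in> A \<Longrightarrow> \<gamma> t \<in> chart_dom c \<Longrightarrow> ((\<lambda>t. \<psi> (\<gamma> t)) has_vector_derivative
      diff_at (F c) (chart_map c (\<gamma> t)) (vector_derivative (chart_map c \<circ> \<gamma>) (at t))) (at t)"
    and "speed \<gamma> t = sqrt (grw_metric f (\<psi> (\<gamma> t))
      (vector_derivative (\<lambda>t. \<psi> (\<gamma> t)) (at t)) (vector_derivative (\<lambda>t. \<psi> (\<gamma> t)) (at t)))"
proof -
  have at: "at t within {a..b} = at t" using at_within_Icc_at t by blast
  show 1: "((\<lambda>t. \<psi> (\<gamma> t)) has_vector_derivative
      diff_at (F c) (chart_map c (\<gamma> t)) (vector_derivative (chart_map c \<circ> \<gamma>) (at t))) (at t)"
    if "c \<in> A" "\<gamma> t \<in> chart_dom c" for c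
    using image_curve_derivative[OF \<gamma> ab C1 _ that] t unfolding at by simp
  have "\<gamma> t \<in> topspace M" using \<gamma> t ab by (auto simp: continuous_map_def)
  from 1[OF chart_at[OF this]] show "speed \<gamma> t = sqrt (grw_metric f (\<psi> (\<gamma> t))
      (vector_derivative (\<lambda>t. \<psi> (\<gamma> t)) (at t)) (vector_derivative (\<lambda>t. \<psi> (\<gamma> t)) (at t)))"
    by (simp add: speed_def Let_def induced_metric_def vector_derivative_at)
qed

lemma speed_integrable:
  assumes \<gamma>: "piecewise_C1_curve M A \<gamma>"
  shows "speed \<gamma> integrable_on {0..1}"
proof -
  obtain S where S: "finite S" "\<And>a b. 0 \<le> a \<Longrightarrow> a < b \<Longrightarrow> b \<le> 1 \<Longrightarrow> {a<..<b} \<inter> S = {} \<Longrightarrow> C1_curve_on A a b \<gamma>"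
    using \<gamma> unfolding piecewise_C1_curve_def by blast
  note cont = curve_point(1)[OF \<gamma>]
  show ?thesis
  proof (rule integrable_on_split_finite[OF S(1)])
    fix a b :: real assume ab: "0 \<le> a" "a < b" "b \<le> 1" and "{a<..<b} \<inter> S = {}"
    then have C1: "C1_curve_on A a b \<gamma>" by (rule S(2))
    let ?B = "\<lambda>t. vector_derivative (\<lambda>t. \<psi> (\<gamma> t)) (at t within {a..b})"
    have B: "continuous_on {a..b} ?B" by (rule continuous_image_curve_derivative[OF cont ab C1])
    have P: "continuous_on {a..b} (\<lambda>t. \<psi> (\<gamma> t))"
      using continuous_image_curve[OF cont] ab by (auto elim: continuous_on_subset)
    have fI: "continuous_on I f"
      by (rule continuous_at_imp_continuous_on) (blast intro: DERIV_isCont deriv)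
    have "continuous_on {a..b} (\<lambda>t. f (\<tau> (\<gamma> t)))"
      by (rule continuous_on_compose2[OF fI continuous_on_fst[OF P]])
        (use \<tau>_in curve_point(2)[OF \<gamma>] ab in auto)
    then have "continuous_on {a..b} (\<lambda>t. sqrt (grw_metric f (\<psi> (\<gamma> t)) (?B t) (?B t)))"
      unfolding grw_metric_def by (intro continuous_intros B)
    then have "(\<lambda>t. sqrt (grw_metric f (\<psi> (\<gamma> t)) (?B t) (?B t))) integrable_on {a..b}"
      by (rule integrable_continuous_interval)
    \<comment> \<open>The speed uses two-sided derivatives, the continuous integrand derivatives
      within the interval; they can differ only at the two end points.\<close>
    then show "speed \<gamma> integrable_on {a..b}"
    proof (rule integrable_spike_finite[of "{a, b}", rotated 2])
      fix t assume "t \<in> {a..b} - {a, b}"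
      then have t: "a < t" "t < b" by auto
      then have "at t within {a..b} = at t" using at_within_Icc_at by blast
      then show "speed \<gamma> t = sqrt (grw_metric f (\<psi> (\<gamma> t)) (?B t) (?B t))"
        using image_curve_derivative_at(2)[OF cont ab C1 t] by simp
    qed simp
  qed simp
qed

lemma curve_length_nonneg:
  assumes \<gamma>: "piecewise_C1_curve M A \<gamma>" shows "0 \<le> curve_length A G \<gamma>"
  unfolding curve_length_speed
  by (rule Henstock_Kurzweil_Integration.integral_nonneg[OF speed_integrable[OF \<gamma>]])
    (rule speed_nonneg[OF curve_point(2)[OF \<gamma>]])

lemma riemannian_dist_le:
  assumes "piecewise_C1_curve M A \<gamma>" "\<gamma> 0 = p" "\<gamma> 1 = q"
  shows "riemannian_dist M A G p q \<le> curve_length A G \<gamma>"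
  unfolding riemannian_dist_def
proof (rule cInf_lower)
  show "bdd_below {curve_length A G \<gamma> |\<gamma>. piecewise_C1_curve M A \<gamma> \<and> \<gamma> 0 = p \<and> \<gamma> 1 = q}"
    using curve_length_nonneg by (intro bdd_belowI[of _ 0]) blast
qed (use assms in blast)

text \<open>By Cauchy-Schwarz the induced metric is at least f^2 (1 - |p|^2) times the Euclidean
  square of the spatial part. This factor is positive and continuous; \<open>k\<close> squared is
  half its value at \<open>q\<close>, which bounds it from below on a small sheet.\<close>

lemma ex_elliptic_sheet:
  assumes q: "q \<in> topspace M"
  shows "\<exists>r \<sigma> k c. sheet (X q) r \<sigma> \<and> \<sigma> (X q) = q \<and> 0 < k \<and> c \<in> A \<and> \<sigma> ` ball (X q) r \<subseteq> chart_dom c \<and>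
    (\<forall>q'\<in>\<sigma> ` ball (X q) r. \<forall>v. k * norm (DX c (chart_map c q') v) \<le> sqrt (G c q' v v))"
proof -
  obtain c where c: "c \<in> A" "q \<in> chart_dom c" using obtain_chart[OF q] .
  interpret P: grw_param f f' "chart_im c" "F c" by (rule param[OF c(1)])
  define y where "y = chart_map c q"
  have y: "y \<in> chart_im c" using c by (simp add: y_def)
  define h where "h z = (f (fst (F c z)))\<^sup>2 * (1 - P.slope z \<bullet> P.slope z)" for z
  have hy: "h y > 0" using P.f_pos[OF y] P.slope_less_1[OF y] by (simp add: h_def)
  have "continuous (at y) h"
    unfolding h_def[abs_def]
    by (intro continuous_intros has_derivative_continuous[OF P.has_derivative_fF[OF y]]
        differentiable_imp_continuous_within[OF P.differentiable_slope[OF y]])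
  then obtain d where d: "d > 0" "\<And>z. dist z y < d \<Longrightarrow> dist (h z) (h y) < h y / 2"
    unfolding continuous_at_eps_delta using hy half_gt_zero by blast
  define k where "k = sqrt (h y / 2)"
  define W where "W = {q' \<in> chart_dom c. chart_map c q' \<in> ball y d}"
  have W: "openin M W" unfolding W_def by (rule openin_chart_preimage[OF c(1)]) simp
  have bound: "k * norm (DX c (chart_map c q') v) \<le> sqrt (G c q' v v)" if "q' \<in> W" for q' v
  proof -
    let ?z = "chart_map c q'"
    let ?\<xi> = "DX c ?z v"
    have z: "?z \<in> chart_im c" "dist ?z y < d" and q': "chart_inv c ?z = q'"
      using that chart_inv_map[OF c(1)] by (auto simp: W_def dist_commute)
    have "h y / 2 \<le> h ?z" using d(2)[OF z(2)] unfolding dist_real_def by linarith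
    then have "h y / 2 * (?\<xi> \<bullet> ?\<xi>) \<le> h ?z * (?\<xi> \<bullet> ?\<xi>)" by (intro mult_right_mono) auto
    also have "\<dots> \<le> (f (fst (F c ?z)))\<^sup>2 * (?\<xi> \<bullet> ?\<xi> - (P.slope ?z \<bullet> ?\<xi>)\<^sup>2)"
      using Cauchy_Schwarz_ineq[of "P.slope ?z" ?\<xi>]
      by (simp add: h_def mult.assoc algebra_simps mult_left_mono)
    also have "\<dots> = G c q' v v"
      using P.metric_diff[OF z(1), of v v] by (simp add: induced_metric_def q' power2_eq_square)
    finally have "sqrt (h y / 2 * (?\<xi> \<bullet> ?\<xi>)) \<le> sqrt (G c q' v v)" by simp
    then show ?thesis unfolding k_def norm_eq_sqrt_inner real_sqrt_mult .
  qed
  obtain r0 \<sigma> where s0: "sheet (X q) r0 \<sigma>" "\<sigma> (X q) = q" using ex_sheet[OF q] by blast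
  have "q \<in> W" using c d(1) by (simp add: W_def y_def)
  moreover have "continuous_map (top_of_set (ball (X q) r0)) M \<sigma>" "0 < r0"
    using s0 by (auto simp: sheet_def)
  ultimately obtain d' where d': "d' > 0" "\<And>z. z \<in> ball (X q) r0 \<Longrightarrow> dist z (X q) < d' \<Longrightarrow> \<sigma> z \<in> W"
    using continuous_map_metricD[of "ball (X q) r0" M \<sigma> "X q" W] W s0(2) by auto
  define r where "r = min r0 d'"
  have "sheet (X q) r \<sigma>" using sheet_shrink[OF s0(1)] \<open>0 < r0\<close> d' by (simp add: r_def)
  moreover have sub: "\<sigma> ` ball (X q) r \<subseteq> W" using d'(2) by (auto simp: r_def dist_commute)
  moreover have "W \<subseteq> chart_dom c" by (auto simp: W_def)
  moreover have "0 < k" using hy by (simp add: k_def)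
  moreover have "\<forall>q'\<in>\<sigma> ` ball (X q) r. \<forall>v. k * norm (DX c (chart_map c q') v) \<le> sqrt (G c q' v v)"
    using bound sub by blast
  ultimately show ?thesis using s0(2) c(1) by blast
qed

text \<open>Compact subsets of a Hausdorff space are closed. This prevents a curve from leaving a
  sheet while its spatial part stays well inside the ball.\<close>

lemma closedin_sheet_cball:
  assumes s: "sheet a r \<sigma>" and r': "r' < r" shows "closedin M (\<sigma> ` cball a r')"
proof (rule compactin_imp_closedin[OF Hausdorff], rule image_compactin)
  have sub: "cball a r' \<subseteq> ball a r" using r' by auto
  then show "compactin (top_of_set (ball a r)) (cball a r')" by (simp add: compactin_subtopology)
  show "continuous_map (top_of_set (ball a r)) M \<sigma>" using s by (simp add: sheet_def)
qed

text \<open>Run backwards from \<open>q\<close>. While the curve stays in the sheet, every unit of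
  spatial distance costs at least \<open>k\<close>, so a length below \<open>k * r\<close> confines
  it to the closed set \<open>K\<close> over a smaller ball. The infimum of the times from which it
  remains in the sheet is then attained and can be lowered, until it reaches 0.\<close>

lemma curve_length_lower_bound:
  assumes s: "sheet (X q) r \<sigma>" "\<sigma> (X q) = q" and k: "0 < k" and c: "c \<in> A" "\<sigma> ` ball (X q) r \<subseteq> chart_dom c"
    and ell: "\<And>q' v. q' \<in> \<sigma> ` ball (X q) r \<Longrightarrow> k * norm (DX c (chart_map c q') v) \<le> sqrt (G c q' v v)"
    and \<gamma>: "piecewise_C1_curve M A \<gamma>" "\<gamma> 1 = q" "\<gamma> 0 \<notin> \<sigma> ` ball (X q) r"
  shows "k * r \<le> curve_length A G \<gamma>"
proof (rule ccontr)
  let ?O = "\<sigma> ` ball (X q) r" and ?len = "curve_length A G \<gamma>"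
  assume "\<not> k * r \<le> ?len"
  then have lt: "?len / k < r" using k by (simp add: pos_divide_less_eq mult.commute)
  define K where "K = \<sigma> ` cball (X q) (?len / k)"
  have K: "closedin M K" unfolding K_def by (rule closedin_sheet_cball[OF s(1) lt])
  have op: "openin M ?O" and r: "0 < r" using s(1) by (auto simp: sheet_def)
  have KO: "K \<subseteq> ?O" using lt by (auto simp: K_def)
  obtain S where S: "finite S" "\<And>a b. 0 \<le> a \<Longrightarrow> a < b \<Longrightarrow> b \<le> 1 \<Longrightarrow> {a<..<b} \<inter> S = {} \<Longrightarrow> C1_curve_on A a b \<gamma>"
    using \<gamma>(1) unfolding piecewise_C1_curve_def by blast
  note cont = curve_point(1)[OF \<gamma>(1)] and pt = curve_point(2)[OF \<gamma>(1)]
  define S' where "S' = insert 0 (insert 1 S)"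
  have S': "finite S'" using S(1) by (simp add: S'_def)
  have inK: "\<gamma> t \<in> K" if t: "t \<in> {0..1}" and O: "\<And>s. s \<in> {t..1} \<Longrightarrow> \<gamma> s \<in> ?O" for t
  proof -
    \<comment> \<open>At break points the derivative is unspecified; the value 0 keeps the bound by
      the speed valid there. The ends 0 and 1 are included, since only interior times carry
      two-sided information.\<close>
    define D where "D s = (if s \<in> S' then 0 else snd (vector_derivative (\<lambda>t. \<psi> (\<gamma> t)) (at s)))" for s
    have der: "((\<lambda>t. X (\<gamma> t)) has_vector_derivative D s) (at s)"
      and bnd: "k * norm (D s) \<le> speed \<gamma> s" if s: "s \<in> {t..1} - S'" for s
    proof -
      have "0 < s" "s < 1" "s \<notin> S" using s t by (auto simp: S'_def order_less_le)
      then obtain a b where ab: "0 \<le> a" "a < s" "s < b" "b \<le> 1" "{a<..<b} \<inter> S = {}"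
        using finite_avoiding_interval[OF S(1)] by metis
      then have C1: "C1_curve_on A a b \<gamma>" using S(2) by auto
      have a_b: "a < b" using ab by simp
      have O': "\<gamma> s \<in> ?O" using O s by auto
      then have dom: "\<gamma> s \<in> chart_dom c" using c(2) by blast
      note d = image_curve_derivative_at[OF cont ab(1) a_b ab(4) C1 ab(2,3)]
      have D: "D s = snd (vector_derivative (\<lambda>t. \<psi> (\<gamma> t)) (at s))" using s by (simp add: D_def)
      have "((\<lambda>t. \<psi> (\<gamma> t)) has_vector_derivative vector_derivative (\<lambda>t. \<psi> (\<gamma> t)) (at s)) (at s)"
        using d(1)[OF c(1) dom] by (simp add: vector_derivative_at)
      then show "((\<lambda>t. X (\<gamma> t)) has_vector_derivative D s) (at s)"
        unfolding D has_vector_derivative_def using has_derivative_snd by fastforce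
      let ?v = "vector_derivative (chart_map c \<circ> \<gamma>) (at s)"
      have B: "vector_derivative (\<lambda>t. \<psi> (\<gamma> t)) (at s) = diff_at (F c) (chart_map c (\<gamma> s)) ?v"
        by (rule vector_derivative_at[OF d(1)[OF c(1) dom]])
      have "speed \<gamma> s = sqrt (G c (\<gamma> s) ?v ?v)" unfolding d(2) B by (simp add: induced_metric_def)
      then show "k * norm (D s) \<le> speed \<gamma> s" using ell[OF O'] by (simp add: D B)
    qed
    have cX: "continuous_on {t..1} (\<lambda>t. X (\<gamma> t))"
      using continuous_on_snd[OF continuous_image_curve[OF cont]] t by (auto elim: continuous_on_subset)
    have int: "(D has_integral (X (\<gamma> 1) - X (\<gamma> t))) {t..1}"
      by (rule fundamental_theorem_of_calculus_interior_strong[OF S' _ _ cX]) (use t der in auto)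
    have si: "speed \<gamma> integrable_on {t..1}"
      using integrable_subinterval_real[OF speed_integrable[OF \<gamma>(1)]] t by simp
    then have "(\<lambda>s. speed \<gamma> s / k) integrable_on {t..1}" by (rule integrable_on_divide)
    then have "norm (integral {t..1} D) \<le> integral {t..1} (\<lambda>s. speed \<gamma> s / k)"
    proof (rule Henstock_Kurzweil_Integration.integral_norm_bound_integral[rotated])
      show "D integrable_on {t..1}" using int by blast
      fix s assume s: "s \<in> {t..1}"
      show "norm (D s) \<le> speed \<gamma> s / k"
      proof (cases "s \<in> S'")
        case True
        then show ?thesis using speed_nonneg[OF pt] s t k by (simp add: D_def)
      next
        case False
        then show ?thesis using bnd[of s] s k by (simp add: pos_le_divide_eq mult.commute)
      qed
    qed
    also have "\<dots> = integral {t..1} (speed \<gamma>) / k" by simp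
    also have "integral {t..1} (speed \<gamma>) \<le> ?len"
      unfolding curve_length_speed using t speed_nonneg[OF pt]
      by (intro integral_subset_le si speed_integrable[OF \<gamma>(1)]) auto
    finally have "norm (integral {t..1} D) \<le> ?len / k" using k by (simp add: divide_right_mono)
    then have "dist (X q) (X (\<gamma> t)) \<le> ?len / k"
      using integral_unique[OF int] by (simp add: \<gamma>(2) dist_norm)
    moreover have "\<sigma> (X (\<gamma> t)) = \<gamma> t" using sheet_X(2)[OF s(1) O] t by simp
    ultimately show ?thesis unfolding K_def by (metis imageI mem_cball)
  qed
  define T where "T = {t \<in> {0..1}. \<forall>s\<in>{t..1}. \<gamma> s \<in> ?O}"
  have "1 \<in> T" 
  proof -
    have "\<sigma> (X q) \<in> ?O" using r by (intro imageI) simp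
    then show ?thesis using \<gamma>(2) s(2) by (simp add: T_def)
  qed
  have T0: "bdd_below T" by (auto simp: T_def intro: bdd_belowI[of _ 0])
  define m where "m = Inf T"
  have "0 \<le> m"
    unfolding m_def
  proof (rule cInf_greatest)
    show "T \<noteq> {}" using \<open>1 \<in> T\<close> by blast
    show "0 \<le> t" if "t \<in> T" for t using that by (simp add: T_def)
  qed
  moreover have "m \<le> 1" unfolding m_def by (rule cInf_lower[OF \<open>1 \<in> T\<close> T0])
  ultimately have m01: "0 \<le> m" "m \<le> 1" .
  have above: "\<gamma> s \<in> K" if "m < s" "s \<le> 1" for s
  proof -
    have "T \<noteq> {}" using \<open>1 \<in> T\<close> by blast
    then have "\<exists>t\<in>T. t < s" by (rule cInf_lessD) (use that(1) in \<open>simp add: m_def\<close>)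
    then obtain t where t: "t \<in> T" "t < s" by blast
    have "s \<in> {0..1}" "\<And>s'. s' \<in> {s..1} \<Longrightarrow> s' \<in> {t..1}" using t that m01 by auto
    then show ?thesis using t(1) unfolding T_def by (intro inK) blast+
  qed
  have mK: "\<gamma> m \<in> K"
  proof (cases "m = 1")
    case True
    have "m \<in> T" using True \<open>1 \<in> T\<close> by simp
    then show ?thesis unfolding T_def by (intro inK) blast+
  next
    case False
    show ?thesis
    proof (rule ccontr)
      assume nK: "\<gamma> m \<notin> K"
      have "openin M (topspace M - K)" using K by blast
      moreover have "\<gamma> m \<in> topspace M - K" using nK pt m01 by simp
      ultimately obtain \<delta> where \<delta>: "\<delta> > 0" "\<And>z. z \<in> {0..1} \<Longrightarrow> dist z m < \<delta> \<Longrightarrow> \<gamma> z \<in> topspace M - K"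
        using continuous_map_metricD[OF cont, of m] m01 by (metis atLeastAtMost_iff)
      define s where "s = min 1 (m + \<delta> / 2)"
      have "m < s" "s \<le> 1" "dist s m < \<delta>" using \<delta>(1) m01 False by (auto simp: s_def dist_real_def)
      then show False using above[of s] \<delta>(2)[of s] m01 by simp
    qed
  qed
  then have mO: "\<gamma> m \<in> ?O" using KO by blast
  obtain \<delta> where \<delta>: "\<delta> > 0" "\<And>z. z \<in> {0..1} \<Longrightarrow> dist z m < \<delta> \<Longrightarrow> \<gamma> z \<in> ?O"
    using continuous_map_metricD[OF cont _ op mO] m01 by (metis atLeastAtMost_iff)
  \<comment> \<open>A time slightly before \<open>m\<close>, cut off at 0. Since it still belongs to
    \<open>T\<close>, it cannot be smaller than \<open>m\<close>; hence \<open>m\<close> is 0 and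
    the starting point would lie in the sheet.\<close>
  define t where "t = max 0 (m - \<delta> / 2)"
  have t: "0 \<le> t" "t \<le> m" "m - \<delta> < t" using \<delta>(1) m01 by (auto simp: t_def)
  have "t \<in> T"
    unfolding T_def
  proof (intro CollectI conjI ballI)
    fix s assume s: "s \<in> {t..1}"
    show "\<gamma> s \<in> ?O"
    proof (cases "s \<le> m")
      case True
      then show ?thesis using \<delta>(2)[of s] s t m01 by (simp add: dist_real_def)
    next
      case False
      then show ?thesis using above[of s] s KO by auto
    qed
  qed (use t m01 in auto)
  then have "m \<le> t" unfolding m_def by (rule cInf_lower[OF _ T0])
  with t have "t = m" by simp
  then have "m = 0" using \<delta>(1) by (auto simp: t_def max_def split: if_splits)
  then show False using mO \<gamma>(3) by simp
qed

text \<open>The time component only decreases the Lorentzian square, so the spatial length is enough.\<close>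

lemma lift_segment:
  assumes s: "lift_on D s" and D: "open D" "closed_segment y z \<subseteq> D"
  defines "\<gamma> \<equiv> \<lambda>t. s (y + t *\<^sub>R (z - y))"
  shows "piecewise_C1_curve M A \<gamma>"
    and "(\<And>w. w \<in> D \<Longrightarrow> f (\<tau> (s w)) \<le> C) \<Longrightarrow> curve_length A G \<gamma> \<le> C * norm (z - y)"
proof -
  let ?l = "\<lambda>t::real. y + t *\<^sub>R (z - y)"
  have l: "?l t \<in> D" if "t \<in> {0..1}" for t
    using that D(2) by (force simp: closed_segment_def algebra_simps)
  have cont: "continuous_map (top_of_set {0..1}) M \<gamma>"
  proof -
    have "continuous_map (top_of_set {0..1}) (top_of_set D) ?l"
      using l by (auto simp: continuous_map_in_subtopology intro!: continuous_intros)
    from continuous_map_compose[OF this, of M s] s show ?thesis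
      by (simp add: lift_on_def \<gamma>_def o_def)
  qed
  \<comment> \<open>The coordinate velocity of the lift: the tangent vector whose spatial part is
    the constant vector \<open>z - y\<close>.\<close>
  define V where "V c t = inv (DX c (chart_map c (\<gamma> t))) (z - y)" for c t
  have der: "((chart_map c \<circ> \<gamma>) has_vector_derivative V c t) (at t)"
    if "t \<in> {0..1}" "c \<in> A" "\<gamma> t \<in> chart_dom c" for c t
    using has_vector_derivative_line[OF lift_derivative[OF s D(1) l[OF that(1)] that(2)]] that(3)
    by (simp add: V_def \<gamma>_def o_def)
  have DXV: "DX c (chart_map c (\<gamma> t)) (V c t) = z - y" if "c \<in> A" "\<gamma> t \<in> chart_dom c" for c t
  proof -
    interpret P: grw_param f f' "chart_im c" "F c" by (rule param[OF that(1)])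
    show ?thesis unfolding V_def by (rule surj_f_inv_f, rule P.surj_DX) (use that in simp)
  qed
  have "C1_curve_on A a b \<gamma>" if ab: "0 \<le> a" "a < b" "b \<le> 1" for a b
    unfolding C1_curve_on_def Let_def
  proof (intro ballI conjI)
    fix c assume c: "c \<in> A"
    interpret P: grw_param f f' "chart_im c" "F c" by (rule param[OF c])
    let ?J = "{t \<in> {a..b}. \<gamma> t \<in> chart_dom c}"
    have der': "((chart_map c \<circ> \<gamma>) has_vector_derivative V c t) (at t)" if "t \<in> ?J" for t
      using der[of t c] that c ab by auto
    show "(chart_map c \<circ> \<gamma>) differentiable (at t within {a..b})" if "t \<in> ?J" for t
      using der'[OF that] differentiableI_vector has_vector_derivative_at_within by blast
    have "V c differentiable (at t within ?J)" if t: "t \<in> ?J" for t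
    proof -
      have im: "chart_map c (\<gamma> t) \<in> chart_im c" using t by simp
      have d: "(\<lambda>t. DX c (chart_map c (\<gamma> t)) w) differentiable (at t within ?J)" for w
      proof -
        have 1: "((\<lambda>t. chart_map c (\<gamma> t)) has_derivative (\<lambda>h. h *\<^sub>R V c t)) (at t within ?J)"
          using der'[OF t] has_derivative_at_withinI by (auto simp: has_vector_derivative_def o_def)
        from has_derivative_compose[OF 1 has_derivative_snd[OF P.has_derivative2[OF im, of w]]]
        show ?thesis unfolding differentiable_def by blast
      qed
      \<comment> \<open>The inverse of DX varies along the curve; Cramer's rule shows that its value
        on the fixed vector \<open>z - y\<close> varies differentiably.\<close>
      have "(\<lambda>t. cramer_solve (matrix (DX c (chart_map c (\<gamma> t)))) (z - y)) differentiable (at t within ?J)"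
        by (rule differentiable_cramer_solve)
          (use P.det_DX[OF im] differentiable_vec_nth[OF d] in \<open>auto simp: matrix_def\<close>)
      then have "(V c has_derivative frechet_derivative
          (\<lambda>t. cramer_solve (matrix (DX c (chart_map c (\<gamma> t)))) (z - y)) (at t within ?J)) (at t within ?J)"
      proof (rule has_derivative_transform[OF t, rotated, OF frechet_derivative_works[THEN iffD1]])
        fix t' assume t': "t' \<in> ?J"
        have im': "chart_map c (\<gamma> t') \<in> chart_im c" using t' by simp
        have "matrix (DX c (chart_map c (\<gamma> t'))) *v V c t' = z - y"
          using DXV[OF c, of t'] t' fun_cong[OF matrix_vector_mul(2)[OF P.linear_DX[OF im']], of "V c t'"] by simp
        then show "V c t' = cramer_solve (matrix (DX c (chart_map c (\<gamma> t')))) (z - y)"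
          using cramer_solve[OF P.det_DX[OF im']] by blast
      qed
      then show ?thesis using differentiableI by blast
    qed
    then have "continuous_on ?J (V c)"
      by (simp add: continuous_on_eq_continuous_within differentiable_imp_continuous_within)
    then show "continuous_on ?J (\<lambda>t. vector_derivative (chart_map c \<circ> \<gamma>) (at t within {a..b}))"
    proof (rule continuous_on_eq)
      fix t assume t: "t \<in> ?J"
      show "V c t = vector_derivative (chart_map c \<circ> \<gamma>) (at t within {a..b})"
        using vector_derivative_at_within_ivl[OF der'[OF t]] t ab by simp
    qed
  qed
  then show pw: "piecewise_C1_curve M A \<gamma>"
    using cont by (auto simp: piecewise_C1_curve_def pathin_def)
  assume C: "\<And>w. w \<in> D \<Longrightarrow> f (\<tau> (s w)) \<le> C"
  have "speed \<gamma> t \<le> C * norm (z - y)" if t: "t \<in> {0..1}" for t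
  proof -
    have "\<gamma> t \<in> topspace M" by (rule curve_point(2)[OF pw t])
    note c = chart_at[OF this]
    let ?c = "chart_at A (\<gamma> t)"
    interpret P: grw_param f f' "chart_im ?c" "F ?c" by (rule param[OF c(1)])
    let ?v = "V ?c t" and ?y = "chart_map ?c (\<gamma> t)"
    have im: "?y \<in> chart_im ?c" and inv: "chart_inv ?c ?y = \<gamma> t" using c chart_inv_map by auto
    have "speed \<gamma> t = sqrt (G ?c (\<gamma> t) ?v ?v)"
      using vector_derivative_at[OF der[OF t c]] by (simp add: speed_def Let_def)
    also have "G ?c (\<gamma> t) ?v ?v \<le> (f (\<tau> (\<gamma> t)))\<^sup>2 * ((z - y) \<bullet> (z - y))"
      using DXV[OF c] by (simp add: induced_metric_def grw_metric_def)
    also have "\<dots> = (f (\<tau> (\<gamma> t)) * norm (z - y))\<^sup>2" by (simp add: power_mult_distrib power2_norm_eq_inner)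
    also have "sqrt \<dots> = f (\<tau> (\<gamma> t)) * norm (z - y)"
      using P.f_pos[OF im] by (simp add: inv)
    also have "\<dots> \<le> C * norm (z - y)" using C[OF l[OF t]] by (simp add: \<gamma>_def mult_right_mono)
    finally show ?thesis by simp
  qed
  then have "integral {0..1} (speed \<gamma>) \<le> integral {0..1::real} (\<lambda>_. C * norm (z - y))"
    by (intro integral_le speed_integrable[OF pw]) auto
  then show "curve_length A G \<gamma> \<le> C * norm (z - y)" by (simp add: curve_length_speed)
qed

text \<open>Each half of a concatenation agrees with a rescaled curve only on a closed interval. All
  derivatives are therefore taken within that interval, which also covers the junction.\<close>

lemma C1_curve_on_affine:
  assumes C1: "C1_curve_on A (k * a + d) (k * b + d) \<gamma>" and k: "0 < k" and ab: "a < b"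
    and eq: "\<And>t. t \<in> {a..b} \<Longrightarrow> \<gamma>' t = \<gamma> (k * t + d)"
  shows "C1_curve_on A a b \<gamma>'"
  unfolding C1_curve_on_def Let_def
proof (rule ballI)
  fix c assume c: "c \<in> A"
  let ?l = "\<lambda>t. k * t + d"
  let ?I = "{?l a..?l b}"
  let ?J = "{t \<in> {a..b}. \<gamma>' t \<in> chart_dom c}" and ?K = "{t \<in> ?I. \<gamma> t \<in> chart_dom c}"
  let ?w = "\<lambda>t. vector_derivative (chart_map c \<circ> \<gamma>) (at t within ?I)"
  have lI: "?l t \<in> ?I" if "t \<in> {a..b}" for t using that k by (auto intro: mult_left_mono)
  have lJ: "?l t \<in> ?K" if "t \<in> ?J" for t using lI[of t] that eq[of t] by auto
  have der: "((chart_map c \<circ> \<gamma>') has_vector_derivative k *\<^sub>R ?w (?l t)) (at t within {a..b})"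
    if t: "t \<in> ?J" for t
  proof -
    have "(chart_map c \<circ> \<gamma>) differentiable (at (?l t) within ?I)"
      using C1 c lJ[OF t] unfolding C1_curve_on_def Let_def by blast
    then have "((chart_map c \<circ> \<gamma>) has_vector_derivative ?w (?l t)) (at (?l t) within ?I)"
      using vector_derivative_works by blast
    then have 2: "((chart_map c \<circ> \<gamma>) has_vector_derivative ?w (?l t)) (at (?l t) within ?l ` {a..b})"
      by (rule has_vector_derivative_within_subset) (use lI in blast)
    have 1: "(?l has_vector_derivative k) (at t within {a..b})"
      by (auto intro!: derivative_eq_intros)
    show ?thesis
      by (rule has_vector_derivative_transform_within[OF vector_diff_chain_within[OF 1 2] zero_less_one])
        (use t eq in auto)
  qed
  show "(\<forall>t\<in>?J. (chart_map c \<circ> \<gamma>') differentiable (at t within {a..b})) \<and>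
        continuous_on ?J (\<lambda>t. vector_derivative (chart_map c \<circ> \<gamma>') (at t within {a..b}))"
  proof
    show "\<forall>t\<in>?J. (chart_map c \<circ> \<gamma>') differentiable (at t within {a..b})"
      using der differentiableI_vector by blast
    have "continuous_on ?K ?w" using C1 c unfolding C1_curve_on_def Let_def by blast
    moreover have "continuous_on ?J ?l" by (intro continuous_intros)
    ultimately have "continuous_on ?J (\<lambda>t. ?w (?l t))"
      by (rule continuous_on_compose2) (use lJ in blast)
    then have "continuous_on ?J (\<lambda>t. k *\<^sub>R ?w (?l t))" by (intro continuous_intros)
    then show "continuous_on ?J (\<lambda>t. vector_derivative (chart_map c \<circ> \<gamma>') (at t within {a..b}))"
    proof (rule continuous_on_eq)
      fix t assume "t \<in> ?J"
      then show "k *\<^sub>R ?w (?l t) = vector_derivative (chart_map c \<circ> \<gamma>') (at t within {a..b})"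
        using vector_derivative_within_closed_interval[OF ab _ der] by simp
    qed
  qed
qed

lemma piecewise_C1_join:
  assumes \<gamma>1: "piecewise_C1_curve M A \<gamma>1" and \<gamma>2: "piecewise_C1_curve M A \<gamma>2" and eq: "\<gamma>1 1 = \<gamma>2 0"
  shows "piecewise_C1_curve M A (\<lambda>t. if t \<le> 1 / 2 then \<gamma>1 (2 * t) else \<gamma>2 (2 * t - 1))"
    (is "piecewise_C1_curve M A ?\<gamma>")
proof -
  note cont = curve_point(1)[OF \<gamma>1] curve_point(1)[OF \<gamma>2]
  have "continuous_map (top_of_set {0..1}) M ?\<gamma>"
  proof (rule continuous_map_cases_le)
    have "continuous_map (top_of_set ({0..1} \<inter> {x. x \<le> 1/2})) (top_of_set {0..1}) (\<lambda>t. 2 * t :: real)"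
      by (auto simp: continuous_map_in_subtopology intro!: continuous_intros)
    from continuous_map_compose[OF this cont(1)]
    show "continuous_map (subtopology (top_of_set {0..1}) {x \<in> topspace (top_of_set {0..1}). x \<le> 1 / 2}) M (\<lambda>t. \<gamma>1 (2 * t))"
      unfolding subtopology_subtopology o_def by (rule back_subst[of "\<lambda>S. continuous_map (top_of_set S) M _"]) auto
    have "continuous_map (top_of_set ({0..1} \<inter> {x. 1/2 \<le> x})) (top_of_set {0..1}) (\<lambda>t. 2 * t - 1 :: real)"
      by (auto simp: continuous_map_in_subtopology intro!: continuous_intros)
    from continuous_map_compose[OF this cont(2)]
    show "continuous_map (subtopology (top_of_set {0..1}) {x \<in> topspace (top_of_set {0..1}). 1 / 2 \<le> x}) M (\<lambda>t. \<gamma>2 (2 * t - 1))"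
      unfolding subtopology_subtopology o_def by (rule back_subst[of "\<lambda>S. continuous_map (top_of_set S) M _"]) auto
  next
    fix t :: real assume "t = 1 / 2"
    then have "2 * t = 1" by simp
    then show "\<gamma>1 (2 * t) = \<gamma>2 (2 * t - 1)" using eq by (simp only: diff_self)
  qed auto
  moreover
  obtain S1 where S1: "finite S1" "\<And>a b. 0 \<le> a \<Longrightarrow> a < b \<Longrightarrow> b \<le> 1 \<Longrightarrow> {a<..<b} \<inter> S1 = {} \<Longrightarrow> C1_curve_on A a b \<gamma>1"
    using \<gamma>1 unfolding piecewise_C1_curve_def by blast
  obtain S2 where S2: "finite S2" "\<And>a b. 0 \<le> a \<Longrightarrow> a < b \<Longrightarrow> b \<le> 1 \<Longrightarrow> {a<..<b} \<inter> S2 = {} \<Longrightarrow> C1_curve_on A a b \<gamma>2"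
    using \<gamma>2 unfolding piecewise_C1_curve_def by blast
  \<comment> \<open>The rescaled break points of both curves together with the junction 1/2, which
    forces every admissible interval into one of the two halves.\<close>
  define S where "S = insert (1/2) ((\<lambda>s. s / 2) ` S1 \<union> (\<lambda>s. (s + 1) / 2) ` S2)"
  have "C1_curve_on A a b ?\<gamma>" if ab: "0 \<le> a" "a < b" "b \<le> 1" and dis: "{a<..<b} \<inter> S = {}" for a b
  proof -
    have nS: "s \<notin> S" if "a < s" "s < b" for s using dis that by auto
    have "\<not> (a < 1/2 \<and> 1/2 < b)" using nS[of "1/2"] by (auto simp: S_def)
    then consider "b \<le> 1/2" | "1/2 \<le> a" by linarith
    then show ?thesis
    proof cases
      case 1
      have "{2 * a<..<2 * b} \<inter> S1 = {}"
      proof (rule ccontr)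
        assume "{2 * a<..<2 * b} \<inter> S1 \<noteq> {}"
        then obtain s where "s \<in> S1" "2 * a < s" "s < 2 * b" by auto
        then show False using nS[of "s / 2"] by (auto simp: S_def)
      qed
      then have "C1_curve_on A (2 * a + 0) (2 * b + 0) \<gamma>1" using S1(2)[of "2 * a" "2 * b"] ab 1 by simp
      then show ?thesis by (rule C1_curve_on_affine) (use ab 1 in auto)
    next
      case 2
      have "{2 * a - 1<..<2 * b - 1} \<inter> S2 = {}"
      proof (rule ccontr)
        assume "{2 * a - 1<..<2 * b - 1} \<inter> S2 \<noteq> {}"
        then obtain s where "s \<in> S2" "2 * a - 1 < s" "s < 2 * b - 1" by auto
        then show False using nS[of "(s + 1) / 2"] by (auto simp: S_def)
      qed
      then have "C1_curve_on A (2 * a + (-1)) (2 * b + (-1)) \<gamma>2"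
        using S2(2)[of "2 * a - 1" "2 * b - 1"] ab 2 by simp
      then show ?thesis
      proof (rule C1_curve_on_affine)
        fix t assume t: "t \<in> {a..b}"
        show "?\<gamma> t = \<gamma>2 (2 * t + (-1))"
        \<comment> \<open>At 1/2 the first branch applies, and the two curves agree there by the
          junction condition.\<close>
        proof (cases "t = 1 / 2")
          case True
          then have "2 * t = 1" by simp
          then show ?thesis using eq True by (simp only:) simp
        next
          case False
          then show ?thesis using t 2 by auto
        qed
      qed (use ab in auto)
    qed
  qed
  moreover have "finite S" using S1(1) S2(1) by (simp add: S_def)
  ultimately show ?thesis unfolding piecewise_C1_curve_def pathin_def by blast
qed

lemma sheet_connected:
  assumes s: "sheet a r \<sigma>" and y: "y \<in> ball a r" and z: "z \<in> ball a r"
  shows "\<exists>\<gamma>. piecewise_C1_curve M A \<gamma> \<and> \<gamma> 0 = \<sigma> y \<and> \<gamma> 1 = \<sigma> z"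
proof -
  have "closed_segment y z \<subseteq> ball a r" using y z by (simp add: closed_segment_subset)
  from lift_segment(1)[OF sheet_lift[OF s] open_ball this]
  show ?thesis by (intro exI[of _ "\<lambda>t. \<sigma> (y + t *\<^sub>R (z - y))"]) simp
qed

text \<open>Two points of one sheet are joined by the lift of a segment. So the points reachable
  from \<open>p\<close>, and equally the unreachable ones, form an open set.\<close>

lemma ex_piecewise_C1_curve:
  assumes conn: "connected_space M" and p: "p \<in> topspace M" and q: "q \<in> topspace M"
  shows "\<exists>\<gamma>. piecewise_C1_curve M A \<gamma> \<and> \<gamma> 0 = p \<and> \<gamma> 1 = q"
proof -
  define R where "R q \<longleftrightarrow> (\<exists>\<gamma>. piecewise_C1_curve M A \<gamma> \<and> \<gamma> 0 = p \<and> \<gamma> 1 = q)" for q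
  have step: "R q''" if s: "sheet a r \<sigma>" and q: "q' \<in> \<sigma> ` ball a r" "q'' \<in> \<sigma> ` ball a r" and R: "R q'"
    for a r \<sigma> q' q''
  proof -
    obtain \<gamma>1 where \<gamma>1: "piecewise_C1_curve M A \<gamma>1" "\<gamma>1 0 = p" "\<gamma>1 1 = q'" using R by (auto simp: R_def)
    obtain \<gamma>2 where \<gamma>2: "piecewise_C1_curve M A \<gamma>2" "\<gamma>2 0 = q'" "\<gamma>2 1 = q''"
      using sheet_connected[OF s] q by (metis imageE)
    have "piecewise_C1_curve M A (\<lambda>t. if t \<le> 1 / 2 then \<gamma>1 (2 * t) else \<gamma>2 (2 * t - 1))"
      by (rule piecewise_C1_join[OF \<gamma>1(1) \<gamma>2(1)]) (simp add: \<gamma>1 \<gamma>2)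
    then show ?thesis
      unfolding R_def
      by (intro exI[of _ "\<lambda>t. if t \<le> 1 / 2 then \<gamma>1 (2 * t) else \<gamma>2 (2 * t - 1)"]) (simp add: \<gamma>1 \<gamma>2)
  qed
  have nbhd: "\<exists>r \<sigma>. sheet (X q) r \<sigma> \<and> openin M (\<sigma> ` ball (X q) r) \<and> q \<in> \<sigma> ` ball (X q) r"
    if "q \<in> topspace M" for q
  proof -
    obtain r \<sigma> where s: "sheet (X q) r \<sigma>" "\<sigma> (X q) = q" using ex_sheet[OF \<open>q \<in> topspace M\<close>] by blast
    then have "q \<in> \<sigma> ` ball (X q) r" by (intro image_eqI[of _ _ "X q"]) (auto simp: sheet_def)
    with s show ?thesis by (auto simp: sheet_def)
  qed
  let ?E = "{q \<in> topspace M. R q}"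
  have "openin M ?E"
    unfolding openin_subopen[of M ?E]
  proof
    fix q assume q: "q \<in> ?E"
    obtain r \<sigma> where s: "sheet (X q) r \<sigma>" "openin M (\<sigma> ` ball (X q) r)" "q \<in> \<sigma> ` ball (X q) r"
      using nbhd[of q] q by blast
    then have "\<sigma> ` ball (X q) r \<subseteq> ?E" using step[OF s(1,3)] q openin_subset[OF s(2)] by blast
    with s(2,3) show "\<exists>T. openin M T \<and> q \<in> T \<and> T \<subseteq> ?E" by blast
  qed
  moreover have "openin M (topspace M - ?E)"
    unfolding openin_subopen[of M "topspace M - ?E"]
  proof
    fix q assume q: "q \<in> topspace M - ?E"
    obtain r \<sigma> where s: "sheet (X q) r \<sigma>" "openin M (\<sigma> ` ball (X q) r)" "q \<in> \<sigma> ` ball (X q) r"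
      using nbhd[of q] q by blast
    then have "\<sigma> ` ball (X q) r \<subseteq> topspace M - ?E"
      using step[OF s(1) _ s(3)] q openin_subset[OF s(2)] by blast
    with s(2,3) show "\<exists>T. openin M T \<and> q \<in> T \<and> T \<subseteq> topspace M - ?E" by blast
  qed
  then have "closedin M ?E" unfolding closedin_def by auto
  moreover have "p \<in> ?E"
  proof -
    obtain r \<sigma> where s: "sheet (X p) r \<sigma>" "\<sigma> (X p) = p" using ex_sheet[OF p] by blast
    then have "X p \<in> ball (X p) r" by (simp add: sheet_def)
    from sheet_connected[OF s(1) this this] show ?thesis using p s(2) by (simp add: R_def)
  qed
  ultimately have "?E = topspace M" using conn unfolding connected_space_clopen_in by blast
  then show ?thesis using q unfolding R_def by blast
qed

text \<open>Connectedness enters because the infimum over an empty set of lengths is an unspecified real.\<close>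

lemma riemannian_dist_topology:
  assumes conn: "connected_space M" and q: "q \<in> topspace M"
  shows "\<exists>r0 \<sigma>. sheet (X q) r0 \<sigma> \<and> \<sigma> (X q) = q \<and>
    (\<forall>r. 0 < r \<and> r \<le> r0 \<longrightarrow> (\<exists>e>0. \<forall>p\<in>topspace M. riemannian_dist M A G p q < e \<longrightarrow> p \<in> \<sigma> ` ball (X q) r))"
proof -
  from ex_elliptic_sheet[OF q] obtain r0 \<sigma> k c where
    E: "sheet (X q) r0 \<sigma> \<and> \<sigma> (X q) = q \<and> 0 < k \<and> c \<in> A \<and> \<sigma> ` ball (X q) r0 \<subseteq> chart_dom c \<and>
      (\<forall>q'\<in>\<sigma> ` ball (X q) r0. \<forall>v. k * norm (DX c (chart_map c q') v) \<le> sqrt (G c q' v v))"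
    by (elim exE) (rule that)
  then have s: "sheet (X q) r0 \<sigma>" "\<sigma> (X q) = q" and k: "0 < k"
    and c: "c \<in> A" "\<sigma> ` ball (X q) r0 \<subseteq> chart_dom c" by blast+
  have ell: "k * norm (DX c (chart_map c q') v) \<le> sqrt (G c q' v v)" if "q' \<in> \<sigma> ` ball (X q) r0" for q' v
    using E that by blast
  \<comment> \<open>The choice e = \<open>k * r\<close> works: if the infimum were below it, some
    actual curve from outside the smaller sheet would be too short.\<close>
  have "p \<in> \<sigma> ` ball (X q) r"
    if r: "0 < r" "r \<le> r0" and p: "p \<in> topspace M" and d: "riemannian_dist M A G p q < k * r" for r p
  proof (rule ccontr)
    assume np: "p \<notin> \<sigma> ` ball (X q) r"
    have sub: "\<sigma> ` ball (X q) r \<subseteq> \<sigma> ` ball (X q) r0" using r by (intro image_mono) auto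
    let ?L = "{curve_length A G \<gamma> |\<gamma>. piecewise_C1_curve M A \<gamma> \<and> \<gamma> 0 = p \<and> \<gamma> 1 = q}"
    have "?L \<noteq> {}" using ex_piecewise_C1_curve[OF conn p q] by blast
    then have "\<exists>l\<in>?L. l < k * r"
      by (rule cInf_lessD) (use d in \<open>simp add: riemannian_dist_def\<close>)
    then obtain \<gamma> where \<gamma>: "piecewise_C1_curve M A \<gamma>" "\<gamma> 0 = p" "\<gamma> 1 = q" "curve_length A G \<gamma> < k * r"
      by blast
    have "k * r \<le> curve_length A G \<gamma>"
    proof (rule curve_length_lower_bound[OF sheet_shrink[OF s(1) r] s(2) k c(1) _ _ \<gamma>(1,3)])
      show "\<gamma> 0 \<notin> \<sigma> ` ball (X q) r" using np \<gamma>(2) by simp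
      show "\<sigma> ` ball (X q) r \<subseteq> chart_dom c" using sub c(2) by blast
    qed (use ell sub in blast)
    with \<gamma>(4) show False by simp
  qed
  then have "\<forall>r. 0 < r \<and> r \<le> r0 \<longrightarrow>
      (\<exists>e>0. \<forall>p\<in>topspace M. riemannian_dist M A G p q < e \<longrightarrow> p \<in> \<sigma> ` ball (X q) r)"
    using mult_pos_pos[OF k] by blast
  with s show ?thesis by blast
qed

end

section \<open>Sections over large balls and the maximum principle\<close>

context grw_hypersurface
begin

text \<open>Approach \<open>y\<close> along a radius. Lifted segments are at most \<open>C\<close>
  times as long as their projections, so the lifted points are Cauchy and converge to some
  \<open>q\<close> in the distance, hence also in the topology of M. Then X q = y, and a sheet
  through \<open>q\<close> agrees with \<open>s\<close> on the convex overlap.\<close>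

lemma lift_boundary:
  assumes conn: "connected_space M" and complete: "complete_riemannian M A G"
    and C: "\<And>q. q \<in> topspace M \<Longrightarrow> f (\<tau> q) \<le> C"
    and R: "0 < R" and s: "lift_on (ball a R) s" and y: "y \<in> cball a R"
  shows "\<exists>\<rho> \<sigma>. sheet y \<rho> \<sigma> \<and> (\<forall>z\<in>ball a R \<inter> ball y \<rho>. s z = \<sigma> z)"
proof -
  \<comment> \<open>Index 0 gives the centre \<open>a\<close>; every term is strictly inside the
    ball, even when \<open>y\<close> lies on the sphere.\<close>
  define z where "z i = y + (1 / real (Suc i)) *\<^sub>R (a - y)" for i
  have lim: "z \<longlonglongrightarrow> y"
    unfolding z_def using tendsto_add[OF tendsto_const tendsto_scaleR[OF lim_1_over_n[THEN LIMSEQ_Suc] tendsto_const]]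
    by fastforce
  have zR: "z i \<in> ball a R" for i
  proof -
    have "z i - a = (1 - 1 / real (Suc i)) *\<^sub>R (y - a)" by (simp add: z_def algebra_simps)
    then have "norm (z i - a) = (1 - 1 / real (Suc i)) * norm (y - a)" by simp
    also have "\<dots> \<le> (1 - 1 / real (Suc i)) * R"
      using y by (intro mult_left_mono) (auto simp: dist_norm norm_minus_commute)
    also have "\<dots> < 1 * R" using R by (intro mult_strict_right_mono) auto
    finally show ?thesis by (simp add: dist_norm norm_minus_commute)
  qed
  have C0: "0 < C"
    using C[OF lift_onD(1)[OF s zR[of 0]]] pos[OF \<tau>_in[OF lift_onD(1)[OF s zR[of 0]]]] by simp
  have dist: "riemannian_dist M A G (s (z i)) (s (z j)) \<le> C * dist (z i) (z j)" for i j
  proof -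
    have sub: "closed_segment (z i) (z j) \<subseteq> ball a R" using zR by (simp add: closed_segment_subset)
    note l = lift_segment[OF s open_ball sub]
    have "riemannian_dist M A G (s (z i)) (s (z j)) \<le> curve_length A G (\<lambda>t. s (z i + t *\<^sub>R (z j - z i)))"
      by (rule riemannian_dist_le[OF l(1)]) simp_all
    also have "\<dots> \<le> C * norm (z j - z i)" by (rule l(2)[OF C]) (rule lift_onD(1)[OF s])
    finally show ?thesis by (simp add: dist_norm norm_minus_commute)
  qed
  have "\<exists>N. \<forall>i\<ge>N. \<forall>j\<ge>N. riemannian_dist M A G (s (z i)) (s (z j)) < e" if "e > 0" for e
  proof -
    have "Cauchy z" using lim LIMSEQ_imp_Cauchy by blast
    then obtain N where "\<forall>i\<ge>N. \<forall>j\<ge>N. dist (z i) (z j) < e / C"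
      using C0 \<open>e > 0\<close> unfolding Cauchy_def by (meson divide_pos_pos)
    then have "\<forall>i\<ge>N. \<forall>j\<ge>N. C * dist (z i) (z j) < e"
      using C0 by (simp add: pos_less_divide_eq mult.commute)
    then show ?thesis using dist by (meson order_le_less_trans)
  qed
  moreover have "range (\<lambda>i. s (z i)) \<subseteq> topspace M" using lift_onD(1)[OF s zR] by blast
  ultimately obtain q where q: "q \<in> topspace M" "(\<lambda>i. riemannian_dist M A G (s (z i)) q) \<longlonglongrightarrow> 0"
    using complete[unfolded complete_riemannian_def, rule_format, of "\<lambda>i. s (z i)"] by blast
  from riemannian_dist_topology[OF conn q(1)] obtain r0 \<sigma> where
    \<sigma>: "sheet (X q) r0 \<sigma>" and near: "\<And>r. 0 < r \<Longrightarrow> r \<le> r0 \<Longrightarrow>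
      \<exists>e>0. \<forall>p\<in>topspace M. riemannian_dist M A G p q < e \<longrightarrow> p \<in> \<sigma> ` ball (X q) r" by blast
  have r0: "0 < r0" using \<sigma> by (simp add: sheet_def)
  have ev: "eventually (\<lambda>i. s (z i) \<in> \<sigma> ` ball (X q) r) sequentially" if r: "0 < r" "r \<le> r0" for r
  proof -
    obtain e where e: "e > 0" "\<forall>p\<in>topspace M. riemannian_dist M A G p q < e \<longrightarrow> p \<in> \<sigma> ` ball (X q) r"
      using near[OF r] by blast
    show ?thesis
      using order_tendstoD(2)[OF q(2) e(1)]
      by eventually_elim (use e(2) lift_onD(1)[OF s zR] in blast)
  qed
  have "z \<longlonglongrightarrow> X q"
  proof (rule tendstoI)
    fix e :: real assume "e > 0"
    then have "eventually (\<lambda>i. s (z i) \<in> \<sigma> ` ball (X q) (min e r0)) sequentially" using r0 by (intro ev) auto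
    then show "eventually (\<lambda>i. dist (z i) (X q) < e) sequentially"
    proof eventually_elim
      case (elim i)
      have "sheet (X q) (min e r0) \<sigma>" using sheet_shrink[OF \<sigma>] r0 \<open>e > 0\<close> by simp
      from sheet_X(1)[OF this elim] show ?case
        using lift_onD(2)[OF s zR] by (simp add: dist_commute)
    qed
  qed
  then have Xq: "X q = y" using LIMSEQ_unique lim by blast
  \<comment> \<open>A single common value of \<open>s\<close> and \<open>\<sigma>\<close> is enough,
    because their domains meet in a connected set.\<close>
  obtain i where i: "s (z i) \<in> \<sigma> ` ball y r0"
    using eventually_happens'[OF _ ev[OF r0 order_refl]] Xq by auto
  have zi: "z i \<in> ball a R \<inter> ball y r0" "s (z i) = \<sigma> (z i)"
    using sheet_X[OF \<sigma>, unfolded Xq, OF i] zR[of i] lift_onD(2)[OF s zR[of i]] by auto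
  have "s w = \<sigma> w" if "w \<in> ball a R \<inter> ball y r0" for w
  proof (rule lift_unique[where D = "ball a R \<inter> ball y r0" and ?z0.0 = "z i"])
    show "lift_on (ball a R \<inter> ball y r0) s" by (rule lift_on_subset[OF s]) auto
    show "lift_on (ball a R \<inter> ball y r0) \<sigma>"
      using sheet_lift[OF \<sigma>] unfolding Xq by (rule lift_on_subset) auto
    show "connected (ball a R \<inter> ball y r0)" by (intro convex_connected convex_Int convex_ball)
  qed (use zi that in auto)
  then show ?thesis using \<sigma> unfolding Xq by blast
qed

text \<open>Sheets continuing \<open>s\<close> exist around every point of the closed ball, and
  compactness gives a uniform gain \<open>e\<close>. They fit together because two overlapping sheet
  domains also overlap inside the open ball, where both sheets equal \<open>s\<close>.\<close>

lemma lift_extend: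
  assumes conn: "connected_space M" and complete: "complete_riemannian M A G"
    and C: "\<And>q. q \<in> topspace M \<Longrightarrow> f (\<tau> q) \<le> C"
    and R: "0 < R" and s: "lift_on (ball a R) s"
  shows "\<exists>R' s'. R < R' \<and> lift_on (ball a R') s' \<and> s' a = s a"
proof -
  have "\<forall>y\<in>cball a R. \<exists>\<rho> \<sigma>. sheet y \<rho> \<sigma> \<and> (\<forall>z\<in>ball a R \<inter> ball y \<rho>. s z = \<sigma> z)"
    using lift_boundary[OF conn complete C R s] by blast
  then obtain \<rho> \<sigma> where sh: "\<And>y. y \<in> cball a R \<Longrightarrow> sheet y (\<rho> y) (\<sigma> y)"
    and eq: "\<And>y z. y \<in> cball a R \<Longrightarrow> z \<in> ball a R \<inter> ball y (\<rho> y) \<Longrightarrow> s z = \<sigma> y z"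
    by metis
  have \<rho>: "0 < \<rho> y" if "y \<in> cball a R" for y using sh[OF that] by (simp add: sheet_def)
  let ?U = "\<Union>y\<in>cball a R. ball y (\<rho> y)"
  have "cball a R \<subseteq> ?U" using \<rho> by force
  moreover have "open ?U" by (intro open_UN ballI open_ball)
  ultimately obtain e where e: "e > 0" "(\<Union>x\<in>cball a R. ball x e) \<subseteq> ?U"
    using compact_subset_open_imp_ball_epsilon_subset[OF compact_cball[of a R], of ?U] by blast
  define R' where "R' = R + e"
  have sub: "ball a R' \<subseteq> ?U"
  proof -
    have "ball a R' \<subseteq> (\<Union>x\<in>cball a R. ball x e)"
    proof
      fix w assume w: "w \<in> ball a R'"
      show "w \<in> (\<Union>x\<in>cball a R. ball x e)"
      proof (cases "dist a w \<le> R")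
        case True
        then show ?thesis using e(1) by (intro UN_I[of w]) auto
      next
        case False
        define d where "d = dist a w"
        have d: "R < d" "d < R + e" using False w by (auto simp: d_def R'_def)
        \<comment> \<open>The radial projection of \<open>w\<close> to the sphere of radius
          \<open>R\<close>, at distance \<open>d - R\<close> from \<open>w\<close>.\<close>
        define x where "x = a + (R / d) *\<^sub>R (w - a)"
        have nd: "norm (w - a) = d" by (simp add: d_def dist_norm norm_minus_commute)
        have "dist a x = R" using d R by (simp add: x_def dist_norm nd)
        moreover have "w - x = (1 - R / d) *\<^sub>R (w - a)" by (simp add: x_def algebra_simps)
        then have "dist x w = (1 - R / d) * d"
          using d R by (simp add: dist_norm norm_minus_commute[of x w] nd)
        then have "dist x w < e" using d R by (simp add: algebra_simps)
        ultimately show ?thesis by (intro UN_I[of x]) auto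
      qed
    qed
    with e(2) show ?thesis by blast
  qed
  have agree: "\<sigma> y1 z = \<sigma> y2 z"
    if y: "y1 \<in> cball a R" "y2 \<in> cball a R" and z: "z \<in> ball y1 (\<rho> y1) \<inter> ball y2 (\<rho> y2)" for y1 y2 z
  proof -
    let ?B = "ball y1 (\<rho> y1) \<inter> ball y2 (\<rho> y2)"
    have r: "0 < \<rho> y1" "0 < \<rho> y2" using \<rho> y by auto
    \<comment> \<open>Dividing the segment between the centres in the ratio of the radii gives a
      point \<open>m\<close> of both balls. By convexity it lies in the closed ball, so the open
      overlap meets the open ball.\<close>
    define \<theta> where "\<theta> = \<rho> y1 / (\<rho> y1 + \<rho> y2)"
    define m where "m = y1 + \<theta> *\<^sub>R (y2 - y1)"
    have \<theta>: "0 < \<theta>" "\<theta> < 1" using r by (auto simp: \<theta>_def)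
    have d: "dist y1 y2 < \<rho> y1 + \<rho> y2"
      using z dist_triangle[of y1 y2 z] by (simp add: dist_commute)
    have "dist y1 m = \<theta> * dist y1 y2" using \<theta> by (simp add: m_def dist_norm norm_minus_commute)
    also have "\<dots> < \<theta> * (\<rho> y1 + \<rho> y2)" using d \<theta> by (intro mult_strict_left_mono) auto
    also have "\<dots> = \<rho> y1" using r by (simp add: \<theta>_def)
    finally have m1: "dist y1 m < \<rho> y1" .
    have "y2 - m = (1 - \<theta>) *\<^sub>R (y2 - y1)" by (simp add: m_def algebra_simps)
    then have "dist y2 m = (1 - \<theta>) * dist y1 y2" using \<theta> by (simp add: dist_norm norm_minus_commute)
    also have "\<dots> < (1 - \<theta>) * (\<rho> y1 + \<rho> y2)" using d \<theta> by (intro mult_strict_left_mono) auto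
    also have "\<dots> = \<rho> y2" using r by (simp add: \<theta>_def field_simps)
    finally have m2: "dist y2 m < \<rho> y2" .
    have "m \<in> closed_segment y1 y2"
      unfolding in_segment m_def using \<theta> by (intro exI[of _ \<theta>]) (simp add: algebra_simps)
    then have "m \<in> cball a R" using y closed_segment_subset[OF y convex_cball] by blast
    then have "m \<in> closure (ball a R)" unfolding closure_ball[OF R] .
    moreover have "m \<in> ?B" using m1 m2 by simp
    moreover have "open ?B" by (intro open_Int open_ball)
    ultimately have "?B \<inter> ball a R \<noteq> {}"
      using open_Int_closure_eq_empty[of ?B "ball a R"] by blast
    then obtain w where w: "w \<in> ?B" "w \<in> ball a R" by blast
    have w_eq: "\<sigma> y1 w = \<sigma> y2 w" using eq[OF y(1), of w] eq[OF y(2), of w] w by simp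
    show ?thesis
    proof (rule lift_unique[where D = ?B and ?z0.0 = w])
      show "lift_on ?B (\<sigma> y1)" "lift_on ?B (\<sigma> y2)"
        using sheet_lift[OF sh[OF y(1)]] sheet_lift[OF sh[OF y(2)]]
        by (auto intro: lift_on_subset)
      show "connected ?B" by (intro convex_connected convex_Int convex_ball)
    qed (use w w_eq z in auto)
  qed
  obtain s' where s': "continuous_map (top_of_set (ball a R')) M s'"
    "\<And>z y. y \<in> cball a R \<Longrightarrow> z \<in> topspace (top_of_set (ball a R')) \<inter> (ball a R' \<inter> ball y (\<rho> y)) \<Longrightarrow> s' z = \<sigma> y z"
  proof (rule pasting_lemma_exists[where X = "top_of_set (ball a R')" and I = "cball a R"
        and T = "\<lambda>y. ball a R' \<inter> ball y (\<rho> y)" and Y = M and f = \<sigma>])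
    show "topspace (top_of_set (ball a R')) \<subseteq> (\<Union>y\<in>cball a R. ball a R' \<inter> ball y (\<rho> y))"
      using sub by auto
    fix y assume y: "y \<in> cball a R"
    show "openin (top_of_set (ball a R')) (ball a R' \<inter> ball y (\<rho> y))" by (simp add: openin_open_Int)
    have "continuous_map (top_of_set (ball y (\<rho> y))) M (\<sigma> y)" using sh[OF y] by (simp add: sheet_def)
    then show "continuous_map (subtopology (top_of_set (ball a R')) (ball a R' \<inter> ball y (\<rho> y))) M (\<sigma> y)"
      unfolding subtopology_subtopology by (rule continuous_map_from_subtopology_mono) auto
  next
    fix y1 y2 z assume "y1 \<in> cball a R" "y2 \<in> cball a R"
      "z \<in> topspace (top_of_set (ball a R')) \<inter> (ball a R' \<inter> ball y1 (\<rho> y1)) \<inter> (ball a R' \<inter> ball y2 (\<rho> y2))"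
    then show "\<sigma> y1 z = \<sigma> y2 z" by (intro agree) auto
  qed (use that in blast)
  have "X (s' z) = z" if z: "z \<in> ball a R'" for z
  proof -
    obtain y where y: "y \<in> cball a R" "z \<in> ball y (\<rho> y)" using sub z by blast
    then have "s' z = \<sigma> y z" using s'(2)[OF y(1), of z] z by simp
    then show ?thesis using sh[OF y(1)] y(2) by (simp add: sheet_def)
  qed
  then have "lift_on (ball a R') s'" using s'(1) by (simp add: lift_on_def)
  moreover have a: "a \<in> cball a R" using R by simp
  then have "s' a = \<sigma> a a" using s'(2)[OF a, of a] \<rho>[OF a] R e(1) by (simp add: R'_def)
  then have "s' a = s a" using eq[OF a, of a] \<rho>[OF a] R by simp
  moreover have "R < R'" using e(1) by (simp add: R'_def)
  ultimately show ?thesis by blast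
qed

text \<open>A continuity argument in the radius. Below the supremum of the admissible radii the
  lifts agree by uniqueness and glue to a lift over the whole open ball; \<open>lift_extend\<close>
  then goes beyond the supremum.\<close>

lemma ex_lift_ball:
  assumes conn: "connected_space M" and complete: "complete_riemannian M A G"
    and C: "\<And>q. q \<in> topspace M \<Longrightarrow> f (\<tau> q) \<le> C"
    and p: "p \<in> topspace M" and R0: "0 < R0"
  shows "\<exists>s. lift_on (ball (X p) R0) s \<and> s (X p) = p"
proof (rule ccontr)
  let ?a = "X p"
  define Q where "Q = {R. 0 < R \<and> (\<exists>s. lift_on (ball ?a R) s \<and> s ?a = p)}"
  assume "\<not> ?thesis"
  then have R0Q: "R0 \<notin> Q" by (simp add: Q_def)
  have down: "r \<in> Q" if "R \<in> Q" "0 < r" "r \<le> R" for r R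
    using that lift_on_subset[of "ball ?a R" _ "ball ?a r"] by (fastforce simp: Q_def)
  \<comment> \<open>Restriction makes the set of admissible radii closed downwards, so a missing
    radius bounds it from above.\<close>
  have bdd: "bdd_above Q" using down[OF _ R0] R0Q by (intro bdd_aboveI[of _ R0]) (meson not_le_imp_less less_imp_le)
  obtain r \<sigma> where \<sigma>: "sheet ?a r \<sigma>" "\<sigma> ?a = p" using ex_sheet[OF p] by blast
  have "r \<in> Q" using \<sigma> sheet_lift[OF \<sigma>(1)] by (auto simp: Q_def sheet_def)
  then have Q_ne: "Q \<noteq> {}" by blast
  define R where "R = Sup Q"
  have R: "0 < R" using cSup_upper[OF \<open>r \<in> Q\<close> bdd] \<open>r \<in> Q\<close> by (simp add: R_def Q_def)
  have "\<forall>r\<in>{0<..<R}. \<exists>s. lift_on (ball ?a r) s \<and> s ?a = p"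
  proof
    fix r assume r: "r \<in> {0<..<R}"
    then have "r < Sup Q" by (simp add: R_def)
    then obtain r' where "r' \<in> Q" "r < r'" using less_cSupD[of Q r] Q_ne by blast
    then have "r \<in> Q" using down r by simp
    then show "\<exists>s. lift_on (ball ?a r) s \<and> s ?a = p" by (simp add: Q_def)
  qed
  then obtain s where s: "\<And>r. r \<in> {0<..<R} \<Longrightarrow> lift_on (ball ?a r) (s r)" "\<And>r. r \<in> {0<..<R} \<Longrightarrow> s r ?a = p"
    by metis
  have agree: "s r z = s r' z" if r: "r \<in> {0<..<R}" "r' \<in> {0<..<R}" and z: "z \<in> ball ?a r \<inter> ball ?a r'" for r r' z
  proof (rule lift_unique[of "ball ?a r \<inter> ball ?a r'" _ _ ?a])
    show "lift_on (ball ?a r \<inter> ball ?a r') (s r)" "lift_on (ball ?a r \<inter> ball ?a r') (s r')"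
      using s(1)[OF r(1)] s(1)[OF r(2)] by (auto intro: lift_on_subset)
    show "connected (ball ?a r \<inter> ball ?a r')" by (intro convex_connected convex_Int convex_ball)
  qed (use r z s(2) in auto)
  obtain s' where s': "continuous_map (top_of_set (ball ?a R)) M s'"
    "\<And>z r. r \<in> {0<..<R} \<Longrightarrow> z \<in> topspace (top_of_set (ball ?a R)) \<inter> ball ?a r \<Longrightarrow> s' z = s r z"
  proof (rule pasting_lemma_exists[where X = "top_of_set (ball ?a R)" and I = "{0<..<R}" and T = "ball ?a" and Y = M and f = s])
    show "topspace (top_of_set (ball ?a R)) \<subseteq> (\<Union>r\<in>{0<..<R}. ball ?a r)"
    proof
      fix z assume "z \<in> topspace (top_of_set (ball ?a R))"
      then have "dist ?a z < R" by simp
      then obtain r where "dist ?a z < r" "r < R" using dense by blast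
      moreover from this have "0 < r" using zero_le_dist[of ?a z] by linarith
      ultimately show "z \<in> (\<Union>r\<in>{0<..<R}. ball ?a r)" by auto
    qed
    fix r assume r: "r \<in> {0<..<R}"
    have "ball ?a R \<inter> ball ?a r = ball ?a r" using r by auto
    then show "openin (top_of_set (ball ?a R)) (ball ?a r)" by (metis open_ball openin_open_Int)
    have "continuous_map (top_of_set (ball ?a r)) M (s r)" using s(1)[OF r] by (simp add: lift_on_def)
    then show "continuous_map (subtopology (top_of_set (ball ?a R)) (ball ?a r)) M (s r)"
      unfolding subtopology_subtopology by (rule continuous_map_from_subtopology_mono) auto
  next
    fix r r' z assume "r \<in> {0<..<R}" "r' \<in> {0<..<R}"
      "z \<in> topspace (top_of_set (ball ?a R)) \<inter> ball ?a r \<inter> ball ?a r'"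
    then show "s r z = s r' z" by (intro agree) auto
  qed (use that in blast)
  have "X (s' z) = z" if z: "z \<in> ball ?a R" for z
  proof -
    have "dist ?a z < R" using z by simp
    then obtain r where r: "dist ?a z < r" "r < R" using dense by blast
    moreover from this have "0 < r" using zero_le_dist[of ?a z] by linarith
    ultimately have r': "r \<in> {0<..<R}" by simp
    then have "s' z = s r z" using s'(2)[OF r', of z] z r by simp
    then show ?thesis using lift_onD(2)[OF s(1)[OF r'], of z] r by simp
  qed
  then have l: "lift_on (ball ?a R) s'" using s'(1) by (simp add: lift_on_def)
  have half: "R / 2 \<in> {0<..<R}" using R by simp
  have "s' ?a = p" using s'(2)[OF half, of ?a] s(2)[OF half] R by simp
  then obtain R' s'' where R': "R < R'" "lift_on (ball ?a R') s''" "s'' ?a = p"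
    using lift_extend[OF conn complete C R l] by metis
  then have "R' \<in> Q" using R by (auto simp: Q_def)
  then have "R' \<le> R" unfolding R_def by (rule cSup_upper[OF _ bdd])
  with R'(1) show False by simp
qed

text \<open>With \<epsilon> = 1 / (8 E) and R = 3 E the paraboloid has height 9 E / 8 on the sphere,
  above the value at the centre, which is less than E; hence the minimum is interior. There
  \<epsilon> |z0 - a|^2 < E gives |p|^2 < 4 \<epsilon> E = 1/2, so f' (1 - |p|^2) is at least 1 / (2
  E), twice the value 2 \<epsilon> = 1 / (4 E) it must exceed.\<close>

lemma ex_mean_curvature_pos:
  fixes \<eta> :: "real \<Rightarrow> real"
  assumes conn: "connected_space M" and complete: "complete_riemannian M A G"
    and C: "\<And>q. q \<in> topspace M \<Longrightarrow> f (\<tau> q) \<le> C"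
    and ne: "topspace M \<noteq> {}"
    and \<eta>: "\<And>t. t \<in> I \<Longrightarrow> (\<eta> has_real_derivative 1 / f t) (at t)"
    and \<eta>0: "\<And>q. q \<in> topspace M \<Longrightarrow> 0 \<le> \<eta> (\<tau> q)"
    and \<eta>1: "\<And>q. q \<in> topspace M \<Longrightarrow> \<eta> (\<tau> q) < E"
    and f': "\<And>q. q \<in> topspace M \<Longrightarrow> 1 / E \<le> f' (\<tau> q)"
  shows "\<exists>c\<in>A. \<exists>y\<in>chart_im c. 0 < mean_curvature (grw_metric f) (F c) y"
proof -
  obtain p where p: "p \<in> topspace M" using ne by blast
  define a where "a = X p"
  have E: "0 < E" using \<eta>0[OF p] \<eta>1[OF p] by simp
  define \<epsilon> where "\<epsilon> = 1 / (8 * E)"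
  have \<epsilon>: "0 < \<epsilon>" using E by (simp add: \<epsilon>_def)
  define R where "R = 3 * E"
  have R: "0 < R" using E by (simp add: R_def)
  have \<epsilon>R: "E < \<epsilon> * R\<^sup>2" using E by (simp add: \<epsilon>_def R_def power2_eq_square)
  \<comment> \<open>The extra unit of radius puts the compact ball of radius \<open>R\<close> inside
    the domain of the section.\<close>
  obtain s where s: "lift_on (ball a (R + 1)) s" "s a = p"
    using ex_lift_ball[OF conn complete C p, of "R + 1"] R by (auto simp: a_def)
  have sub: "cball a R \<subseteq> ball a (R + 1)" by auto
  have sM: "s z \<in> topspace M" "X (s z) = z" if "z \<in> cball a R" for z
    using lift_onD[OF s(1)] sub that by blast+
  define u where "u z = \<eta> (\<tau> (s z)) + \<epsilon> * (norm (z - a))\<^sup>2" for z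
  have \<tau>s: "continuous_on (cball a R) (\<lambda>z. \<tau> (s z))"
  proof -
    have "continuous_map (top_of_set (ball a (R + 1))) euclidean (\<psi> \<circ> s)"
      using s(1) by (intro continuous_map_compose[OF _ continuous_\<psi>]) (simp add: lift_on_def)
    then have "continuous_on (ball a (R + 1)) (\<lambda>z. \<psi> (s z))" by (simp add: o_def)
    from continuous_on_subset[OF continuous_on_fst[OF this] sub] show ?thesis .
  qed
  have "continuous_on I \<eta>"
    by (rule continuous_at_imp_continuous_on) (blast intro: DERIV_isCont \<eta>)
  then have "continuous_on (cball a R) (\<lambda>z. \<eta> (\<tau> (s z)))"
    by (rule continuous_on_compose2[OF _ \<tau>s]) (blast intro: \<tau>_in sM(1))
  then have "continuous_on (cball a R) u" unfolding u_def[abs_def] by (intro continuous_intros)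
  moreover have "cball a R \<noteq> {}" using R by simp
  ultimately obtain z0 where z0: "z0 \<in> cball a R" "\<And>z. z \<in> cball a R \<Longrightarrow> u z0 \<le> u z"
    using continuous_attains_inf[OF compact_cball] by metis
  have "u z0 \<le> u a" by (rule z0(2)) (use R in simp)
  also have "u a < E" using \<eta>1[OF p] by (simp add: u_def s(2))
  finally have small: "\<epsilon> * (norm (z0 - a))\<^sup>2 < E" using \<eta>0[OF sM(1)[OF z0(1)]] by (simp add: u_def)
  then have "\<epsilon> * (norm (z0 - a))\<^sup>2 < \<epsilon> * R\<^sup>2" using \<epsilon>R by simp
  then have "(norm (z0 - a))\<^sup>2 < R\<^sup>2" using \<epsilon> by simp
  then have "norm (z0 - a) < R" using R by (simp add: power_less_imp_less_base)
  then have inner: "z0 \<in> ball a R" by (simp add: dist_norm norm_minus_commute)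
  define q where "q = s z0"
  have q: "q \<in> topspace M" "X q = z0" using sM[OF z0(1)] by (auto simp: q_def)
  obtain c where c: "c \<in> A" "q \<in> chart_dom c" using obtain_chart[OF q(1)] .
  interpret P: grw_param f f' "chart_im c" "F c" by (rule param[OF c(1)])
  define y where "y = chart_map c q"
  have y: "y \<in> chart_im c" "chart_inv c y = q" using c chart_inv_map by (auto simp: y_def)
  obtain r \<sigma> where \<sigma>: "sheet (X q) r \<sigma>" "\<sigma> (X q) = q" using ex_sheet[OF q(1)] by blast
  have r: "0 < r" using \<sigma> by (simp add: sheet_def)
  obtain d where d: "d > 0" "ball z0 d \<subseteq> ball a R" using inner open_ball by (meson openE)
  define \<rho> where "\<rho> = min r d"
  have \<rho>: "0 < \<rho>" "ball z0 \<rho> \<subseteq> ball a R" using r d by (auto simp: \<rho>_def)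
  have sh: "sheet z0 \<rho> \<sigma>" using sheet_shrink[OF \<sigma>(1), of \<rho>] r d(1) by (simp add: q(2) \<rho>_def)
  have eq: "\<sigma> z = s z" if "z \<in> ball z0 \<rho>" for z
  proof (rule lift_unique[where D = "ball z0 \<rho>" and ?z0.0 = z0])
    show "lift_on (ball z0 \<rho>) s" using \<rho>(2) sub by (intro lift_on_subset[OF s(1)]) auto
    show "z0 \<in> ball z0 \<rho>" using \<rho>(1) by simp
    show "\<sigma> z0 = s z0" using \<sigma>(2) by (simp add: q(2)) (simp add: q_def)
    show "connected (ball z0 \<rho>)" by (intro convex_connected convex_ball)
  qed (use sheet_lift[OF sh] that in auto)
  have op: "openin M (\<sigma> ` ball z0 \<rho>)" using sh by (simp add: sheet_def)
  \<comment> \<open>The minimum of \<open>u\<close> on the slice is carried over to the chart: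
    points of M near \<open>q\<close> lie in the open image of the sheet, where the sheet is the
    section \<open>s\<close>, so the penalised \<eta> at such a point is \<open>u\<close> at its
    spatial part.\<close>
  have "chart_inv c y \<in> \<sigma> ` ball z0 \<rho>"
    unfolding y(2) using \<sigma>(2) \<rho>(1) by (intro image_eqI[of _ _ z0]) (auto simp: q(2))
  then obtain \<delta> where \<delta>: "\<delta> > 0"
    "\<And>w. w \<in> chart_im c \<Longrightarrow> dist w y < \<delta> \<Longrightarrow> chart_inv c w \<in> \<sigma> ` ball z0 \<rho>"
    using continuous_map_metricD[OF continuous_chart_inv[OF c(1)] y(1) op] by metis
  have "0 < mean_curvature (grw_metric f) (F c) y"
  proof (rule P.mean_curvature_pos_at_local_min[OF y(1)])
    have "4 * \<epsilon>\<^sup>2 * (norm (z0 - a))\<^sup>2 = 4 * \<epsilon> * (\<epsilon> * (norm (z0 - a))\<^sup>2)" by (simp add: power2_eq_square)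
    also have "\<dots> < 4 * \<epsilon> * E" using small \<epsilon> by (intro mult_strict_left_mono) auto
    also have "\<dots> = 1 / 2" using E by (simp add: \<epsilon>_def)
    finally have 1: "1 / 2 < 1 - 4 * \<epsilon>\<^sup>2 * (norm (z0 - a))\<^sup>2" by simp
    have "2 * \<epsilon> < 1 / E * (1 / 2)" using E by (simp add: \<epsilon>_def field_simps)
    also have "\<dots> \<le> f' (\<tau> q) * (1 - 4 * \<epsilon>\<^sup>2 * (norm (z0 - a))\<^sup>2)"
      using f'[OF q(1)] 1 E order.trans[OF _ f'[OF q(1)], of 0] by (intro mult_mono) auto
    finally show "2 * \<epsilon> < f' (fst (F c y)) * (1 - 4 * \<epsilon>\<^sup>2 * (norm (snd (F c y) - a))\<^sup>2)"
      by (simp add: y(2) q(2))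
    show "0 \<le> \<epsilon>" using \<epsilon> by simp
    show "(\<eta> has_real_derivative 1 / f (fst (F c w))) (at (fst (F c w)))" if w: "w \<in> chart_im c" for w
      using chart_inv_in[OF w] dom_subset[OF c(1)] by (intro \<eta>) (auto intro: \<tau>_in)
    show "eventually (\<lambda>w. \<eta> (fst (F c y)) + \<epsilon> * (norm (snd (F c y) - a))\<^sup>2
      \<le> \<eta> (fst (F c w)) + \<epsilon> * (norm (snd (F c w) - a))\<^sup>2) (nhds y)"
      using eventually_nhds_in_open[OF open_im[OF c(1)] y(1)]
        eventually_nhds_in_open[OF open_ball centre_in_ball[THEN iffD2, OF \<delta>(1)], of y]
    proof eventually_elim
      case (elim w)
      let ?p = "chart_inv c w"
      have p: "?p \<in> \<sigma> ` ball z0 \<rho>" by (rule \<delta>(2)) (use elim in \<open>auto simp: dist_commute\<close>)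
      have Xp: "X ?p \<in> ball z0 \<rho>" "s (X ?p) = ?p" using sheet_X[OF sh p] eq by auto
      have "u z0 \<le> u (X ?p)" using Xp(1) \<rho>(2) by (intro z0(2)) auto
      then show ?case by (simp add: u_def Xp(2) y(2) q(2) flip: q_def)
    qed
  qed
  with c(1) y(1) show ?thesis by blast
qed

end

section \<open>Specialization to the Einstein-de Sitter spacetime\<close>

theorem corollary6:
  assumes "CARD('n::finite) \<ge> 2"
  shows "\<not> (\<exists>(M :: 'a topology) (A :: ('a, 'n) chart set) (\<psi> :: 'a \<Rightarrow> 'n spacetime).
    topspace M \<noteq> {} \<and> connected_space M \<and>
    spacelike_hypersurface eds_domain eds_metric M A \<psi> \<and>
    complete_hypersurface eds_metric M A \<psi> \<and>
    maximal_hypersurface eds_metric A \<psi> \<and>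
    bounded_away_from_future_infinity M \<psi>)"
proof (intro notI, elim exE conjE)
  fix M :: "'a topology" and A :: "('a, 'n) chart set" and \<psi> :: "'a \<Rightarrow> 'n spacetime"
  assume ne: "topspace M \<noteq> {}" and conn: "connected_space M"
    and hyp: "spacelike_hypersurface eds_domain eds_metric M A \<psi>"
    and complete: "complete_hypersurface eds_metric M A \<psi>"
    and maximal: "maximal_hypersurface eds_metric A \<psi>"
    and bounded: "bounded_away_from_future_infinity M \<psi>"
  define f :: "real \<Rightarrow> real" where "f t = t powr (2/3)" for t
  define f' :: "real \<Rightarrow> real" where "f' t = 2/3 * t powr (-1/3)" for t
  define \<eta> :: "real \<Rightarrow> real" where "\<eta> t = 3 * t powr (1/3)" for t
  have eds: "eds_metric = (grw_metric f :: 'n spacetime \<Rightarrow> _)"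
    by (simp add: eds_metric_def f_def[abs_def])
  interpret grw_hypersurface f f' "{0<..}" M A \<psi>
  proof
    show "spacelike_hypersurface (grw_domain {0<..}) (grw_metric f) M A \<psi>"
      using hyp by (simp add: eds eds_domain_def)
    fix t :: real assume t: "t \<in> {0<..}"
    show "0 < f t" using t by (simp add: f_def)
    show "(f has_real_derivative f' t) (at t)"
      using has_real_derivative_powr[of t "2/3"] t unfolding f_def f'_def by simp
  qed
  obtain T where T: "\<And>q. q \<in> topspace M \<Longrightarrow> \<tau> q \<le> T"
    using bounded unfolding bounded_away_from_future_infinity_def bdd_above_def by auto
  have \<tau>0: "0 < \<tau> q" if "q \<in> topspace M" for q using \<tau>_in[OF that] by simp
  have "\<exists>c\<in>A. \<exists>y\<in>chart_im c. 0 < mean_curvature (grw_metric f) (F c) y"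
  proof (rule ex_mean_curvature_pos[OF conn _ _ ne])
    show "complete_riemannian M A G" using complete by (simp add: complete_hypersurface_def eds)
    show "f (\<tau> q) \<le> T powr (2/3)" if "q \<in> topspace M" for q
      using T[OF that] \<tau>0[OF that] by (simp add: f_def powr_mono2)
    show "(\<eta> has_real_derivative 1 / f t) (at t)" if "t \<in> {0<..}" for t
    proof -
      have "(\<eta> has_real_derivative 3 * (1/3 * t powr (1/3 - 1))) (at t)"
        unfolding \<eta>_def using that by (intro DERIV_cmult has_real_derivative_powr) simp
      then show ?thesis using powr_minus_divide[of t "2/3"] by (simp add: f_def)
    qed
    fix q assume q: "q \<in> topspace M"
    \<comment> \<open>The summand 1 makes the upper bound for \<eta> strict. The bound on f' follows
      from f' = 2 / \<eta>, since 1 / E is below 1 / \<eta>.\<close>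
    let ?E = "3 * T powr (1/3) + 1"
    show "0 \<le> \<eta> (\<tau> q)" by (simp add: \<eta>_def)
    have le: "\<tau> q powr (1/3) \<le> T powr (1/3)" using T[OF q] \<tau>0[OF q] by (simp add: powr_mono2)
    then show "\<eta> (\<tau> q) < ?E" by (simp add: \<eta>_def)
    have pos: "0 < \<tau> q powr (1/3)" using \<tau>0[OF q] by simp
    have "1 / ?E \<le> 1 / (3 * \<tau> q powr (1/3))" by (rule frac_le) (use le pos in auto)
    also have "\<dots> \<le> 2 / (3 * \<tau> q powr (1/3))" using pos by (intro divide_right_mono) auto
    also have "\<dots> = f' (\<tau> q)" using powr_minus_divide[of "\<tau> q" "1/3"] by (simp add: f'_def)
    finally show "1 / ?E \<le> f' (\<tau> q)" .
  qed
  then obtain c y where "c \<in> A" "y \<in> chart_im c" "0 < mean_curvature (grw_metric f) (F c) y" by blast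
  then show False using maximal unfolding maximal_hypersurface_def eds by force
qed

end
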